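(* In the setting described in the context, assume that there exists a constant $\epsilon>0$ such that, for every $k\ge1$ and every integer $l\ge2$, $$\mathbb E\big[(H_{k,\varepsilon_k}(X_{k-1},\ldots,X_1,\varepsilon_k))^l\big]\le\frac12\,\frac{l!\,\epsilon^{l-2}}{(l-1)^{l/2}}\;\mathbb E\big[(H_{k,\varepsilon_k}(X_{k-1},\ldots,X_1,\varepsilon_k))^2\big].$$ Let $$V_n^2=\sum_{k=1}^n\big(a_{n-k}(n-k)\big)^2\,\mathbb E\big[(H_{k,\varepsilon_k}(X_{k-1},\ldots,X_1,\varepsilon_k))^2\big],\qquad \sigma_n^2=\frac1nV_n^2,$$ with $V_n,\sigma_n$ the nonnegative square roots, and $0<V_n<\infty$. Then, for either choice of sign and every $x>0$, $$\mathbb P(\pm S_n\ge xV_n)\le\exp\Big(\frac{-x^2}{1+\sqrt{1+2x\epsilon\,a_{n-1}(n-1)/\sigma_n}+x\epsilon\,a_{n-1}(n-1)/\sigma_n}\Big)\le\exp\Big(\frac{-x^2}{2\big(1+x\epsilon\,a_{n-1}(n-1)/\sigma_n\big)}\Big).$$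
   Context: Let $(\mathcal X,d)$ and $(\mathcal Y,\delta)$ be complete separable metric spaces. Let $(\varepsilon_i)_{i\ge1}$ be independent (not necessarily identically distributed) $\mathcal Y$-valued random variables, with $P_{\varepsilon_k}$ the law of $\varepsilon_k$. Let $(X_i)_{i\le0}$ be a deterministic sequence in $\mathcal X$. For each $m\ge1$ let $F_m:\mathcal X^{\mathbb N}\times\mathcal Y\to\mathcal X$ be measurable, and define recursively $X_m=F_m((X_{m-i})_{i\ge1};\varepsilon_m)$ for $m\ge1$. Assume there are nonnegative numbers $a_i$, $i\ge1$, with $\sum_{i\ge1}a_i<1$, such that for all $m\ge1$ and all sequences $(x_{m-i})_{i\ge1},(x'_{m-i})_{i\ge1}$ in $\mathcal X$, $$\mathbb E\big[d\big(F_m((x_{m-i})_{i\ge1};\varepsilon_m),F_m((x'_{m-i})_{i\ge1};\varepsilon_m)\big)\big]\le\sum_{i=1}^\infty a_i\,d(x_{m-i},x'_{m-i}).$$ Fix $n\ge1$ and let $f:\mathcal X^n\to\mathbb R$ satisfy $|f(x_1,\ldots,x_n)-f(x'_1,\ldots,x'_n)|\le\sum_{i=1}^n d(x_i,x'_i)$. Put $S_n=f(X_1,\ldots,X_n)-\mathbb E[f(X_1,\ldots,X_n)]$. The numbers $a_k(k)$, $k\ge0$, are defined recursively by $a_0(0)=1$ and $a_k(k)=1+a_k+\sum_{l=1}^{k-1}a_l(l)\,a_{k-l}$ for $k\ge1$ (so $a_1(1)=1+a_1$). For $k\ge1$, $$H_{k,\varepsilon_k}(X_{k-1},\ldots,X_1,\varepsilon_k)=\int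 d\big(F_k(X_{k-1},\ldots,X_1,X_0,X_{-1},\ldots;\varepsilon_k),F_k(X_{k-1},\ldots,X_1,X_0,X_{-1},\ldots;y)\big)P_{\varepsilon_k}(dy),$$ which for $k=1$ is $H_{1,\varepsilon_1}(\varepsilon_1)=\int d(F_1(X_0,X_{-1},\ldots;\varepsilon_1),F_1(X_0,X_{-1},\ldots;y))P_{\varepsilon_1}(dy)$. *)

theory Defs
  imports "HOL-Probability.Probability"
begin

text \<open>
  Complete separable metric spaces are rendered by the class \<^class>\<open>polish_space\<close>, i.e. a complete
  metric space whose topology is second countable. The process is indexed by \<^typ>\<open>int\<close>. A sequence
  $(x_{m-i})_{i \ge 1}$ in the state space is a function \<open>x :: nat \<Rightarrow> 'x\<close> with \<open>x j\<close> standing for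
  $x_{m-(j+1)}$, the most recent value first.
  A separately Lipschitz function of $(x_1,\ldots,x_n)$ is a function \<open>f :: (nat \<Rightarrow> 'x) \<Rightarrow> real\<close> with
  $|f(u) - f(u')| \le \sum_{i=1}^n d(u_i,u'_i)$ for all $u,u'$; this bound already forces \<open>f\<close> to depend
  on the coordinates \<open>1..n\<close> only.
\<close>

definition past :: "(int \<Rightarrow> 'w \<Rightarrow> 'x) \<Rightarrow> nat \<Rightarrow> 'w \<Rightarrow> nat \<Rightarrow> 'x" where
  "past X m \<omega> = (\<lambda>j. X (int m - int (Suc j)) \<omega>)"

text \<open>The numbers $a_k(k)$; the value \<open>a 0\<close> is never used.\<close>

fun lip_coef :: "(nat \<Rightarrow> real) \<Rightarrow> nat \<Rightarrow> real" where
  "lip_coef a 0 = 1"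
| "lip_coef a (Suc k) = 1 + a (Suc k) + (\<Sum>l=1..k. lip_coef a l * a (Suc k - l))"

text \<open>
  The random variable $H_{k,\varepsilon_k}(X_{k-1},\ldots,X_1,\varepsilon_k)$. Nothing makes the
  defining integral finite a priori, so it takes values in \<^typ>\<open>ennreal\<close>, and so do its moments.
\<close>

definition H_var :: "'w measure \<Rightarrow> (nat \<Rightarrow> (nat \<Rightarrow> 'x::polish_space) \<times> 'y::polish_space \<Rightarrow> 'x) \<Rightarrow> (nat \<Rightarrow> 'w \<Rightarrow> 'y)
    \<Rightarrow> (int \<Rightarrow> 'w \<Rightarrow> 'x) \<Rightarrow> nat \<Rightarrow> 'w \<Rightarrow> ennreal"
  where
  "H_var M F noise X k \<omega> =
     (\<integral>\<^sup>+ y. ennreal (dist (F k (past X k \<omega>, noise k \<omega>)) (F k (past X k \<omega>, y)))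
        \<partial>distr M borel (noise k))"

definition V_sq :: "'w measure \<Rightarrow> (nat \<Rightarrow> (nat \<Rightarrow> 'x::polish_space) \<times> 'y::polish_space \<Rightarrow> 'x) \<Rightarrow> (nat \<Rightarrow> 'w \<Rightarrow> 'y)
    \<Rightarrow> (int \<Rightarrow> 'w \<Rightarrow> 'x) \<Rightarrow> (nat \<Rightarrow> real) \<Rightarrow> nat \<Rightarrow> ennreal"
  where
  "V_sq M F noise X a n =
     (\<Sum>k=1..n. ennreal ((lip_coef a (n - k))\<^sup>2) * (\<integral>\<^sup>+ \<omega>. (H_var M F noise X k \<omega>)\<^sup>2 \<partial>M))"

end

theory Submission
  imports Defs
begin

text \<open>
  The functions \<open>cond_mean\<close> obtained from \<open>f\<close> by integrating out the last
  innovations are again separately Lipschitz, and the recursion for the Lipschitz constant in the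
  last remaining variable is the one that defines $a_k(k)$. Hence the martingale increments of
  $S_n$ satisfy $|D_k| \le a_{n-k}(n-k) H_k$. Since only unconditional moments of $H_k$ are
  controlled, the exponential martingale method does not apply; instead Rio's inequality
  $\|S_n\|_l^2 \le (l-1) \sum_k \|D_k\|_l^2$ and the power mean inequality give
  $E|S_n|^l \le (l-1)^{l/2} n^{l/2-1} \sum_k E|D_k|^l$. The factor $(l-1)^{l/2}$ cancels the
  denominator of the moment assumption, which leaves the Bernstein condition
  $E|S_n|^l \le \frac12 l!\, C^{l-2} V_n^2$ with $C = \sqrt n\, \epsilon\, a_{n-1}(n-1)$, and
  Markov's inequality for $e^{tS_n}$ finishes the proof.
\<close>

section \<open>Rio's moment inequality for martingales\<close>

text \<open>Conditional expectations never appear. The history up to time k is a measurable function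
  of the first k innovations, so its joint law with the next innovation is a product, and Fubini's
  theorem does the work of conditioning. Of the martingale property, Rio's inequality uses only that
  D_{k+1} is orthogonal to the signed power T_k |T_k|^(l-2) of the partial sum. The obstacle behind
  the construction is integrability, since no moment of the states or of f is assumed finite.
  Finiteness of V_n makes H_k square integrable for k \<le> n, hence finite at some \<omega>. This
  provides one point at finite mean distance from the next state, and the contraction carries the
  finiteness over to every past. The factor sqrt n in C is the price of the power mean inequality,
  as n^(l/2-1) = (sqrt n)^(l-2); since V_n = sqrt n \<sigma>_n, the ratio C / V_n is exactly the
  \<epsilon> a_{n-1}(n-1) / \<sigma>_n of the claim. Only absolute moments are estimated, so both
  signs are covered at once.\<close>

lemma has_real_derivative_signed_power:
  fixes z :: real
  shows "((\<lambda>z. z * \<bar>z\<bar> ^ m) has_real_derivative (real m + 1) * \<bar>z\<bar> ^ m) (at z)"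
proof (cases z "0::real" rule: linorder_cases)
  case less
  have "((\<lambda>z. z * (- z) ^ m) has_real_derivative (real m + 1) * \<bar>z\<bar> ^ m) (at z)"
    apply (rule derivative_eq_intros refl)+
    using less by (cases m) (simp_all add: algebra_simps)
  then show ?thesis
    by (rule has_field_derivative_transform_within_open[where S = "{..<0}"]) (use less in auto)
next
  case equal
  show ?thesis
  proof (cases m)
    case (Suc k)
    \<comment> \<open>At the origin the difference quotient is |h|^m itself, which tends to 0
      because m is positive here.\<close>
    have "((\<lambda>h. \<bar>h\<bar> ^ m) \<longlongrightarrow> 0) (at (0::real))"
      using Suc by (auto intro!: tendsto_eq_intros)
    then have "((\<lambda>h. (h * \<bar>h\<bar> ^ m) / h) \<longlongrightarrow> 0) (at (0::real))"
      by (rule Lim_transform_eventually) (auto simp: eventually_at_filter)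
    then show ?thesis using equal Suc by (simp add: has_field_derivative_iff)
  qed simp
next
  case greater
  have "((\<lambda>z. z * z ^ m) has_real_derivative (real m + 1) * \<bar>z\<bar> ^ m) (at z)"
    apply (rule derivative_eq_intros refl)+
    using greater by (cases m) (simp_all add: algebra_simps)
  then show ?thesis
    by (rule has_field_derivative_transform_within_open[where S = "{0<..}"]) (use greater in auto)
qed

text \<open>Writing |z|^(m+2) as z times the signed power reduces this to the product rule. Together
  the two lemmas differentiate |z|^p twice for p = m + 2, with no exception at 0.\<close>

lemma has_real_derivative_abs_power:
  fixes z :: real
  shows "((\<lambda>z. \<bar>z\<bar> ^ (m + 2)) has_real_derivative (real m + 2) * (z * \<bar>z\<bar> ^ m)) (at z)"
proof -
  have eq: "(\<lambda>z::real. \<bar>z\<bar> ^ (m + 2)) = (\<lambda>z. z * (z * \<bar>z\<bar> ^ m))"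
    by (auto simp: fun_eq_iff power_add power2_eq_square algebra_simps abs_mult_self_eq
        simp flip: power2_abs)
  show ?thesis unfolding eq
    by (rule derivative_eq_intros has_real_derivative_signed_power refl)+ (simp add: algebra_simps)
qed

text \<open>The mean value inequality bounds the difference quotients by \<open>g\<close>, so
  domination is needed only for t within distance 1 of \<open>t0\<close>; dominated convergence is
  then applied along sequences.\<close>

lemma has_real_derivative_integral:
  fixes f f' :: "real \<Rightarrow> 'a \<Rightarrow> real"
  assumes int: "\<And>t. integrable M (f t)"
    and der: "\<And>t \<omega>. ((\<lambda>t. f t \<omega>) has_real_derivative f' t \<omega>) (at t)"
    and bound: "\<And>t \<omega>. \<bar>t - t0\<bar> < 1 \<Longrightarrow> \<bar>f' t \<omega>\<bar> \<le> g \<omega>"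
    and g: "integrable M g"
    and meas: "f' t0 \<in> borel_measurable M"
  shows "((\<lambda>t. \<integral>\<omega>. f t \<omega> \<partial>M) has_real_derivative (\<integral>\<omega>. f' t0 \<omega> \<partial>M)) (at t0)"
proof -
  have [measurable]: "f t \<in> borel_measurable M" for t using int by auto
  note [measurable] = meas
  have "((\<lambda>t. ((\<integral>\<omega>. f t \<omega> \<partial>M) - (\<integral>\<omega>. f t0 \<omega> \<partial>M)) / (t - t0)) \<longlongrightarrow> (\<integral>\<omega>. f' t0 \<omega> \<partial>M))
      (at t0 within {t0 - 1<..<t0 + 1})"
    unfolding tendsto_at_iff_sequentially comp_def
  proof (intro allI impI)
    fix u :: "nat \<Rightarrow> real"
    assume u: "\<forall>i. u i \<in> {t0 - 1<..<t0 + 1} - {t0}" and lim: "u \<longlonglongrightarrow> t0"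
    have "(\<lambda>i. \<integral>\<omega>. (f (u i) \<omega> - f t0 \<omega>) / (u i - t0) \<partial>M) \<longlonglongrightarrow> (\<integral>\<omega>. f' t0 \<omega> \<partial>M)"
    proof (rule integral_dominated_convergence[where w = g])
      show "AE \<omega> in M. (\<lambda>i. (f (u i) \<omega> - f t0 \<omega>) / (u i - t0)) \<longlonglongrightarrow> f' t0 \<omega>"
      proof (rule AE_I2)
        fix \<omega>
        have "((\<lambda>t. (f t \<omega> - f t0 \<omega>) / (t - t0)) \<longlongrightarrow> f' t0 \<omega>) (at t0)"
          using der[where t = t0 and \<omega> = \<omega>] by (simp add: has_field_derivative_iff)
        then show "(\<lambda>i. (f (u i) \<omega> - f t0 \<omega>) / (u i - t0)) \<longlonglongrightarrow> f' t0 \<omega>"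
          unfolding tendsto_at_iff_sequentially comp_def using u lim by auto
      qed
      show "AE \<omega> in M. norm ((f (u i) \<omega> - f t0 \<omega>) / (u i - t0)) \<le> g \<omega>" for i
      proof (rule AE_I2)
        fix \<omega>
        define S where "S = {t0 - 1<..<t0 + 1}"
        have "norm (f (u i) \<omega> - f t0 \<omega>) \<le> g \<omega> * norm (u i - t0)"
          by (rule field_differentiable_bound[of S _ "\<lambda>t. f' t \<omega>"])
            (use u in \<open>auto simp: S_def intro!: bound has_field_derivative_at_within der\<close>)
        then show "norm ((f (u i) \<omega> - f t0 \<omega>) / (u i - t0)) \<le> g \<omega>"
          using u by (simp add: divide_simps)
      qed
    qed (use g in auto)
    then show "(\<lambda>i. ((\<integral>\<omega>. f (u i) \<omega> \<partial>M) - (\<integral>\<omega>. f t0 \<omega> \<partial>M)) / (u i - t0)) \<longlonglongrightarrow> (\<integral>\<omega>. f' t0 \<omega> \<partial>M)"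
      using int by simp
  qed
  then show ?thesis
    unfolding has_field_derivative_iff by (subst (asm) at_within_open) auto
qed

text \<open>Supplies an envelope for |X + t Y| over |t| \<le> c. For u, v \<ge> 0, u + v \<le> 2
  max(u, v) gives (u + v)^l \<le> 2^l (u^l + v^l).\<close>

lemma integrable_abs_power_sum:
  fixes X Y :: "'a \<Rightarrow> real"
  assumes [measurable]: "X \<in> borel_measurable M" "Y \<in> borel_measurable M"
    and "integrable M (\<lambda>\<omega>. \<bar>X \<omega>\<bar> ^ l)" "integrable M (\<lambda>\<omega>. \<bar>Y \<omega>\<bar> ^ l)"
  shows "integrable M (\<lambda>\<omega>. (\<bar>X \<omega>\<bar> + c * \<bar>Y \<omega>\<bar>) ^ l)"
proof (rule Bochner_Integration.integrable_bound)
  show "integrable M (\<lambda>\<omega>. 2 ^ l * (\<bar>X \<omega>\<bar> ^ l + \<bar>c\<bar> ^ l * \<bar>Y \<omega>\<bar> ^ l))"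
    using assms by auto
  show "AE \<omega> in M. norm ((\<bar>X \<omega>\<bar> + c * \<bar>Y \<omega>\<bar>) ^ l) \<le> norm (2 ^ l * (\<bar>X \<omega>\<bar> ^ l + \<bar>c\<bar> ^ l * \<bar>Y \<omega>\<bar> ^ l))"
  proof (rule AE_I2)
    fix \<omega>
    have "\<bar>\<bar>X \<omega>\<bar> + c * \<bar>Y \<omega>\<bar>\<bar> \<le> \<bar>X \<omega>\<bar> + \<bar>c\<bar> * \<bar>Y \<omega>\<bar>"
      by (metis abs_abs abs_mult abs_triangle_ineq)
    also have "\<dots> \<le> 2 * max \<bar>X \<omega>\<bar> (\<bar>c\<bar> * \<bar>Y \<omega>\<bar>)" by auto
    finally have "\<bar>\<bar>X \<omega>\<bar> + c * \<bar>Y \<omega>\<bar>\<bar> ^ l \<le> (2 * max \<bar>X \<omega>\<bar> (\<bar>c\<bar> * \<bar>Y \<omega>\<bar>)) ^ l"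
      by (intro power_mono) auto
    also have "\<dots> \<le> 2 ^ l * (\<bar>X \<omega>\<bar> ^ l + \<bar>c\<bar> ^ l * \<bar>Y \<omega>\<bar> ^ l)"
      by (auto simp: power_mult_distrib max_def)
    finally show "norm ((\<bar>X \<omega>\<bar> + c * \<bar>Y \<omega>\<bar>) ^ l) \<le> norm (2 ^ l * (\<bar>X \<omega>\<bar> ^ l + \<bar>c\<bar> ^ l * \<bar>Y \<omega>\<bar> ^ l))"
      by (simp add: power_abs)
  qed
qed measurable

text \<open>Hoelder's inequality with exponents (m+2)/m and (m+2)/2, obtained by integrating Young's
  inequality for normalised functions. The shift by \<open>\<delta>\<close> keeps the normalising
  constants positive even if a norm vanishes.\<close>

lemma integral_abs_power_mult_square_le:
  fixes Z Y :: "'a \<Rightarrow> real"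
  assumes [measurable]: "Z \<in> borel_measurable M" "Y \<in> borel_measurable M"
    and iZ: "integrable M (\<lambda>\<omega>. \<bar>Z \<omega>\<bar> ^ (m + 2))" and iY: "integrable M (\<lambda>\<omega>. \<bar>Y \<omega>\<bar> ^ (m + 2))"
    and \<delta>: "\<delta> > 0"
  shows "(\<integral>\<omega>. \<bar>Z \<omega>\<bar> ^ m * (Y \<omega>)\<^sup>2 \<partial>M)
    \<le> ((\<integral>\<omega>. \<bar>Z \<omega>\<bar> ^ (m + 2) \<partial>M) + \<delta>) powr (m / (m + 2)) * ((\<integral>\<omega>. \<bar>Y \<omega>\<bar> ^ (m + 2) \<partial>M) + \<delta>) powr (2 / (m + 2))"
proof -
  define A where "A = (\<integral>\<omega>. \<bar>Z \<omega>\<bar> ^ (m + 2) \<partial>M)"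
  define B where "B = (\<integral>\<omega>. \<bar>Y \<omega>\<bar> ^ (m + 2) \<partial>M)"
  define c where "c = (A + \<delta>) powr (m / (m + 2)) * (B + \<delta>) powr (2 / (m + 2))"
  have A0: "0 \<le> A" and B0: "0 \<le> B" unfolding A_def B_def by auto
  have c0: "c > 0" using A0 B0 \<delta> by (simp add: c_def)
  have pw: "\<bar>z\<bar> ^ m * y\<^sup>2 \<le> c * (m / (m + 2) * \<bar>z\<bar> ^ (m + 2) / (A + \<delta>) + 2 / (m + 2) * \<bar>y\<bar> ^ (m + 2) / (B + \<delta>))"
    (is "_ \<le> c * ?R") for z y :: real
  \<comment> \<open>Young's inequality is used for positive arguments only; in this case the
    left-hand side is 0. The condition m > 0 matters because |0|^0 = 1.\<close>
  proof (cases "y = 0 \<or> z = 0 \<and> m > 0")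
    case True
    have "0 \<le> ?R" using A0 B0 \<delta> by (intro add_nonneg_nonneg divide_nonneg_nonneg mult_nonneg_nonneg) auto
    then have "0 \<le> c * ?R" using c0 by (intro mult_nonneg_nonneg) auto
    moreover have "\<bar>z\<bar> ^ m * y\<^sup>2 = 0" using True by auto
    ultimately show ?thesis by linarith
  next
    case False
    show ?thesis
    proof (cases "m = 0")
      case True
      \<comment> \<open>For m = 0 the first Hoelder exponent would be infinite; here
        \<open>c\<close> is just B + \<delta>.\<close>
      then show ?thesis using A0 B0 \<delta> by (simp add: c_def divide_simps power2_eq_square)
    next
      case m: False
      then have z: "z \<noteq> 0" and y: "y \<noteq> 0" using False by auto
      have pw1: "(\<bar>z\<bar> ^ (m + 2)) powr (m / (m + 2)) = \<bar>z\<bar> ^ m"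
      proof -
        have "(\<bar>z\<bar> ^ (m + 2)) powr (m / (m + 2)) = \<bar>z\<bar> powr (real (m + 2) * (m / real (m + 2)))"
          using z by (simp only: powr_powr flip: powr_realpow zero_less_abs_iff)
        also have "real (m + 2) * (m / real (m + 2)) = real m" by simp
        finally show ?thesis using z by (simp add: powr_realpow)
      qed
      have pw2: "(\<bar>y\<bar> ^ (m + 2)) powr (2 / (m + 2)) = \<bar>y\<bar> ^ 2"
      proof -
        have "(\<bar>y\<bar> ^ (m + 2)) powr (2 / (m + 2)) = \<bar>y\<bar> powr (real (m + 2) * (2 / real (m + 2)))"
          using y by (simp only: powr_powr flip: powr_realpow zero_less_abs_iff)
        also have "real (m + 2) * (2 / real (m + 2)) = real 2"
          by (subst times_divide_eq_right, subst nonzero_mult_div_cancel_left) simp_all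
        finally show ?thesis using y by (simp add: powr_realpow)
      qed
      have "(\<bar>z\<bar> ^ (m + 2) / (A + \<delta>)) powr (m / (m + 2)) * (\<bar>y\<bar> ^ (m + 2) / (B + \<delta>)) powr (2 / (m + 2))
          \<le> m / (m + 2) * (\<bar>z\<bar> ^ (m + 2) / (A + \<delta>)) + 2 / (m + 2) * (\<bar>y\<bar> ^ (m + 2) / (B + \<delta>))"
        by (rule Youngs_inequality_0)
          (use z y A0 B0 \<delta> in \<open>simp_all del: power_add add: divide_pos_pos flip: add_divide_distrib\<close>)
      moreover have "(\<bar>z\<bar> ^ (m + 2) / (A + \<delta>)) powr (m / (m + 2)) = \<bar>z\<bar> ^ m / (A + \<delta>) powr (m / (m + 2))"
        unfolding pw1[symmetric] by (rule powr_divide)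
      moreover have "(\<bar>y\<bar> ^ (m + 2) / (B + \<delta>)) powr (2 / (m + 2)) = \<bar>y\<bar> ^ 2 / (B + \<delta>) powr (2 / (m + 2))"
        unfolding pw2[symmetric] by (rule powr_divide)
      ultimately have "\<bar>z\<bar> ^ m * y\<^sup>2 / c \<le> ?R"
        by (simp only: c_def times_divide_eq_left times_divide_eq_right divide_divide_eq_left power2_abs)
      then show ?thesis using c0 by (simp only: pos_divide_le_eq mult.commute[of c])
    qed
  qed
  have R: "integrable M (\<lambda>\<omega>. c * (m / (m + 2) * \<bar>Z \<omega>\<bar> ^ (m + 2) / (A + \<delta>) + 2 / (m + 2) * \<bar>Y \<omega>\<bar> ^ (m + 2) / (B + \<delta>)))"
    using iZ iY by (intro integrable_mult_right Bochner_Integration.integrable_add) auto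
  have "(\<integral>\<omega>. \<bar>Z \<omega>\<bar> ^ m * (Y \<omega>)\<^sup>2 \<partial>M)
      \<le> (\<integral>\<omega>. c * (m / (m + 2) * \<bar>Z \<omega>\<bar> ^ (m + 2) / (A + \<delta>) + 2 / (m + 2) * \<bar>Y \<omega>\<bar> ^ (m + 2) / (B + \<delta>)) \<partial>M)"
    by (rule integral_mono'[OF R pw]) (rule order.trans[OF _ pw], simp)
  also have "\<dots> = c * (m / (m + 2) * A / (A + \<delta>) + 2 / (m + 2) * B / (B + \<delta>))"
    using iZ iY by (simp add: A_def B_def del: power_add power_Suc)
  \<comment> \<open>Both normalised moments are at most 1, and the weights m/(m+2) and 2/(m+2) add
    up to 1.\<close>
  also have "\<dots> \<le> c * 1"
  proof (rule mult_left_mono)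
    have "m / (m + 2) * (A / (A + \<delta>)) \<le> m / (m + 2) * 1"
      by (intro mult_left_mono) (use A0 \<delta> in auto)
    moreover have "2 / (m + 2) * (B / (B + \<delta>)) \<le> 2 / (m + 2) * 1"
      by (intro mult_left_mono) (use B0 \<delta> in auto)
    moreover have "m / (m + 2) + 2 / (m + 2) = (1::real)" by (simp add: divide_simps)
    ultimately show "m / (m + 2) * A / (A + \<delta>) + 2 / (m + 2) * B / (B + \<delta>) \<le> 1" by simp
  qed (use c0 in simp)
  finally show ?thesis by (simp add: c_def A_def B_def add.commute)
qed

text \<open>
  Due to Rio. With $p = m+2$ and $\varphi(t) = E|X+tY|^p$, the orthogonality hypothesis says $\varphi'(0) = 0$ and Hoelder's
  inequality gives $(\varphi^{2/p})'' \le 2(p-1) \|Y\|_p^2$; the shift by $\delta$ keeps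
  $\varphi$ away from $0$.
\<close>

lemma Lp_norm_square_add_le:
  fixes X Y :: "'a \<Rightarrow> real"
  assumes X[measurable]: "X \<in> borel_measurable M" and Y[measurable]: "Y \<in> borel_measurable M"
    and iX: "integrable M (\<lambda>\<omega>. \<bar>X \<omega>\<bar> ^ (m + 2))" and iY: "integrable M (\<lambda>\<omega>. \<bar>Y \<omega>\<bar> ^ (m + 2))"
    and orth: "(\<integral>\<omega>. (X \<omega> * \<bar>X \<omega>\<bar> ^ m) * Y \<omega> \<partial>M) = 0"
  shows "(\<integral>\<omega>. \<bar>X \<omega> + Y \<omega>\<bar> ^ (m + 2) \<partial>M) powr (2 / (m + 2))
    \<le> (\<integral>\<omega>. \<bar>X \<omega>\<bar> ^ (m + 2) \<partial>M) powr (2 / (m + 2))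
      + (m + 1) * (\<integral>\<omega>. \<bar>Y \<omega>\<bar> ^ (m + 2) \<partial>M) powr (2 / (m + 2))"
proof -
  define Z where "Z t \<omega> = X \<omega> + t * Y \<omega>" for t \<omega>
  define \<phi> where "\<phi> t = (\<integral>\<omega>. \<bar>Z t \<omega>\<bar> ^ (m + 2) \<partial>M)" for t
  define \<phi>' where "\<phi>' t = (\<integral>\<omega>. (m + 2) * (Z t \<omega> * \<bar>Z t \<omega>\<bar> ^ m) * Y \<omega> \<partial>M)" for t
  define \<phi>'' where "\<phi>'' t = (\<integral>\<omega>. (m + 2) * ((m + 1) * \<bar>Z t \<omega>\<bar> ^ m * Y \<omega>) * Y \<omega> \<partial>M)" for t
  define B where "B = (\<integral>\<omega>. \<bar>Y \<omega>\<bar> ^ (m + 2) \<partial>M)"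
  have [measurable]: "Z t \<in> borel_measurable M" for t unfolding Z_def by measurable
  have dom1: "\<bar>Z t \<omega>\<bar> \<le> \<bar>X \<omega>\<bar> + c * \<bar>Y \<omega>\<bar>" if "\<bar>t\<bar> \<le> c" for t \<omega> c
  proof -
    have "\<bar>Z t \<omega>\<bar> \<le> \<bar>X \<omega>\<bar> + \<bar>t\<bar> * \<bar>Y \<omega>\<bar>" unfolding Z_def by (metis abs_mult abs_triangle_ineq)
    also have "\<dots> \<le> \<bar>X \<omega>\<bar> + c * \<bar>Y \<omega>\<bar>" using that by (intro add_left_mono mult_right_mono) auto
    finally show ?thesis .
  qed
  \<comment> \<open>With 1 \<le> c the envelope dominates |Y| as well as |Z t|, so one power
    controls every mixed product. The later choice c = |t| + 1 also covers all s with |s - t| <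
    1.\<close>
  have dom: "\<bar>Z t \<omega>\<bar> ^ i * \<bar>Y \<omega>\<bar> ^ j \<le> (\<bar>X \<omega>\<bar> + c * \<bar>Y \<omega>\<bar>) ^ (i + j)"
    if "\<bar>t\<bar> \<le> c" "1 \<le> c" for t \<omega> c i j
  proof -
    have "1 * \<bar>Y \<omega>\<bar> \<le> c * \<bar>Y \<omega>\<bar>" using that by (intro mult_right_mono) auto
    then have "\<bar>Y \<omega>\<bar> \<le> \<bar>X \<omega>\<bar> + c * \<bar>Y \<omega>\<bar>" using abs_ge_zero[of "X \<omega>"] by linarith
    then have "\<bar>Z t \<omega>\<bar> ^ i * \<bar>Y \<omega>\<bar> ^ j \<le> (\<bar>X \<omega>\<bar> + c * \<bar>Y \<omega>\<bar>) ^ i * (\<bar>X \<omega>\<bar> + c * \<bar>Y \<omega>\<bar>) ^ j"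
      using dom1[OF that(1)] that by (intro mult_mono power_mono) auto
    then show ?thesis by (simp only: power_add)
  qed
  note intG = integrable_abs_power_sum[OF X Y iX iY]
  have intZ: "integrable M (\<lambda>\<omega>. \<bar>Z t \<omega>\<bar> ^ i * \<bar>Y \<omega>\<bar> ^ j)" if "i + j = m + 2" for t i j
  proof (rule Bochner_Integration.integrable_bound[OF intG[of "\<bar>t\<bar> + 1"]])
    show "AE \<omega> in M. norm (\<bar>Z t \<omega>\<bar> ^ i * \<bar>Y \<omega>\<bar> ^ j) \<le> norm ((\<bar>X \<omega>\<bar> + (\<bar>t\<bar> + 1) * \<bar>Y \<omega>\<bar>) ^ (m + 2))"
      using dom[of t "\<bar>t\<bar> + 1" _ i j] by (intro AE_I2) (simp add: that abs_mult power_abs[symmetric])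
  qed measurable
  have intZ0: "integrable M (\<lambda>\<omega>. \<bar>Z t \<omega>\<bar> ^ (m + 2))" for t using intZ[of "m + 2" 0] by simp
  have d1: "(\<phi> has_real_derivative \<phi>' t) (at t)" for t
    unfolding \<phi>_def \<phi>'_def
  proof (rule has_real_derivative_integral[where g = "\<lambda>\<omega>. (m + 2) * (\<bar>X \<omega>\<bar> + (\<bar>t\<bar> + 1) * \<bar>Y \<omega>\<bar>) ^ (m + 2)"])
    show "((\<lambda>t. \<bar>Z t \<omega>\<bar> ^ (m + 2)) has_real_derivative (m + 2) * (Z s \<omega> * \<bar>Z s \<omega>\<bar> ^ m) * Y \<omega>) (at s)" for s \<omega>
      unfolding Z_def
      by (rule DERIV_chain2[OF has_real_derivative_abs_power, THEN DERIV_cong])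
        (auto intro!: derivative_eq_intros)
    show "\<bar>(m + 2) * (Z s \<omega> * \<bar>Z s \<omega>\<bar> ^ m) * Y \<omega>\<bar> \<le> (m + 2) * (\<bar>X \<omega>\<bar> + (\<bar>t\<bar> + 1) * \<bar>Y \<omega>\<bar>) ^ (m + 2)"
      if "\<bar>s - t\<bar> < 1" for s \<omega>
    proof -
      have "\<bar>(m + 2) * (Z s \<omega> * \<bar>Z s \<omega>\<bar> ^ m) * Y \<omega>\<bar> = (m + 2) * (\<bar>Z s \<omega>\<bar> ^ (m + 1) * \<bar>Y \<omega>\<bar> ^ 1)"
        by (simp add: abs_mult mult.assoc)
      also have "\<dots> \<le> (m + 2) * (\<bar>X \<omega>\<bar> + (\<bar>t\<bar> + 1) * \<bar>Y \<omega>\<bar>) ^ (m + 1 + 1)"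
        using that by (intro mult_left_mono dom) auto
      finally show ?thesis by simp
    qed
    show "integrable M (\<lambda>\<omega>. real (m + 2) * (\<bar>X \<omega>\<bar> + (\<bar>t\<bar> + 1) * \<bar>Y \<omega>\<bar>) ^ (m + 2))"
      by (intro integrable_mult_right intG)
  qed (use intZ0 in measurable)
  have d2: "(\<phi>' has_real_derivative \<phi>'' t) (at t)" for t
    unfolding \<phi>'_def \<phi>''_def
  proof (rule has_real_derivative_integral[where g = "\<lambda>\<omega>. real (m + 2) * real (m + 1) * (\<bar>X \<omega>\<bar> + (\<bar>t\<bar> + 1) * \<bar>Y \<omega>\<bar>) ^ (m + 2)"])
    show "integrable M (\<lambda>\<omega>. (m + 2) * (Z s \<omega> * \<bar>Z s \<omega>\<bar> ^ m) * Y \<omega>)" for s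
    proof (rule Bochner_Integration.integrable_bound)
      show "integrable M (\<lambda>\<omega>. (m + 2) * (\<bar>Z s \<omega>\<bar> ^ (m + 1) * \<bar>Y \<omega>\<bar> ^ 1))"
        by (intro integrable_mult_right intZ) simp
    qed (measurable, simp add: abs_mult mult.assoc)
    show "((\<lambda>t. (m + 2) * (Z t \<omega> * \<bar>Z t \<omega>\<bar> ^ m) * Y \<omega>) has_real_derivative
        (m + 2) * ((m + 1) * \<bar>Z s \<omega>\<bar> ^ m * Y \<omega>) * Y \<omega>) (at s)" for s \<omega>
      unfolding Z_def
      by (intro DERIV_cmult_right DERIV_cmult, rule DERIV_chain2[OF has_real_derivative_signed_power, THEN DERIV_cong])
        (auto intro!: derivative_eq_intros)
    show "\<bar>(m + 2) * ((m + 1) * \<bar>Z s \<omega>\<bar> ^ m * Y \<omega>) * Y \<omega>\<bar> \<le> real (m + 2) * real (m + 1) * (\<bar>X \<omega>\<bar> + (\<bar>t\<bar> + 1) * \<bar>Y \<omega>\<bar>) ^ (m + 2)"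
      if "\<bar>s - t\<bar> < 1" for s \<omega>
    proof -
      have "\<bar>(m + 2) * ((m + 1) * \<bar>Z s \<omega>\<bar> ^ m * Y \<omega>) * Y \<omega>\<bar> = real (m + 2) * real (m + 1) * (\<bar>Z s \<omega>\<bar> ^ m * \<bar>Y \<omega>\<bar> ^ 2)"
        by (simp add: abs_mult mult_ac power2_eq_square del: power2_abs abs_mult_self_eq)
      also have "\<dots> \<le> real (m + 2) * real (m + 1) * (\<bar>X \<omega>\<bar> + (\<bar>t\<bar> + 1) * \<bar>Y \<omega>\<bar>) ^ (m + 2)"
        using that by (intro mult_left_mono dom) auto
      finally show ?thesis by simp
    qed
    show "integrable M (\<lambda>\<omega>. real (m + 2) * real (m + 1) * (\<bar>X \<omega>\<bar> + (\<bar>t\<bar> + 1) * \<bar>Y \<omega>\<bar>) ^ (m + 2))"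
      by (intro integrable_mult_right intG)
  qed measurable
  have \<phi>0: "0 \<le> \<phi> t" for t unfolding \<phi>_def by simp
  have B0: "0 \<le> B" unfolding B_def by simp
  have \<phi>'0: "\<phi>' 0 = 0"
    using orth by (simp add: \<phi>'_def Z_def mult.assoc)
  define q where "q = 2 / (real m + 2)"
  have q: "0 < q" "q \<le> 1" by (auto simp: q_def divide_simps)
  have main: "(\<phi> 1 + \<delta>) powr q \<le> (\<phi> 0 + \<delta>) powr q + (m + 1) * (B + \<delta>) powr q" if \<delta>: "\<delta> > 0" for \<delta>
  proof -
    define \<psi> where "\<psi> t = (\<phi> t + \<delta>) powr q" for t
    define \<psi>' where "\<psi>' t = q * (\<phi> t + \<delta>) powr (q - 1) * \<phi>' t" for t
    define \<psi>'' where "\<psi>'' t = q * ((q - 1) * (\<phi> t + \<delta>) powr (q - 1 - 1) * \<phi>' t) * \<phi>' t + q * (\<phi> t + \<delta>) powr (q - 1) * \<phi>'' t" for t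
    have pos: "\<phi> t + \<delta> > 0" for t using \<phi>0[of t] \<delta> by linarith
    have e1: "(\<psi> has_real_derivative \<psi>' t) (at t)" for t
      unfolding \<psi>_def \<psi>'_def
      by (rule derivative_eq_intros d1 refl pos)+ (simp add: powr_diff field_simps)
    have e2: "(\<psi>' has_real_derivative \<psi>'' t) (at t)" for t
      unfolding \<psi>'_def \<psi>''_def
      apply (rule derivative_eq_intros d1 d2 refl pos)+
      using pos[of t] by (simp add: powr_diff divide_simps algebra_simps)
    \<comment> \<open>Second-order Taylor expansion of \<psi> on [0, 1]; its linear term vanishes
      since \<phi>'(0) = 0.\<close>
    have "\<exists>t. 0 < t \<and> t < 1 \<and> \<psi> 1 = (\<Sum>i<2. ([\<psi>, \<psi>', \<psi>''] ! i) 0 / fact i * 1 ^ i) + ([\<psi>, \<psi>', \<psi>''] ! 2) t / fact 2 * 1 ^ 2"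
      by (rule Maclaurin) (auto simp: less_2_cases_iff e1 e2)
    then obtain t where t: "\<psi> 1 = \<psi> 0 + \<psi>' 0 + \<psi>'' t / 2"
      by (auto simp: eval_nat_numeral)
    \<comment> \<open>The part containing (\<phi>')^2 carries the factor q - 1 \<le> 0 and is
      dropped. This is where the exponent being at least 2 enters.\<close>
    have "\<psi>'' t \<le> q * (\<phi> t + \<delta>) powr (q - 1) * \<phi>'' t"
    proof -
      have "q * ((q - 1) * (\<phi> t + \<delta>) powr (q - 1 - 1) * \<phi>' t) * \<phi>' t
          = - (q * (1 - q) * (\<phi> t + \<delta>) powr (q - 1 - 1) * (\<phi>' t)\<^sup>2)"
        by (simp add: power2_eq_square algebra_simps)
      also have "\<dots> \<le> 0" using q by simp
      finally show ?thesis by (simp add: \<psi>''_def)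
    qed
    also have "\<phi>'' t = real (m + 2) * real (m + 1) * (\<integral>\<omega>. \<bar>Z t \<omega>\<bar> ^ m * (Y \<omega>)\<^sup>2 \<partial>M)"
      unfolding \<phi>''_def by (subst integral_mult_right_zero[symmetric]) (simp add: power2_eq_square mult_ac)
    also have "q * (\<phi> t + \<delta>) powr (q - 1) * (real (m + 2) * real (m + 1) * (\<integral>\<omega>. \<bar>Z t \<omega>\<bar> ^ m * (Y \<omega>)\<^sup>2 \<partial>M))
        \<le> q * (\<phi> t + \<delta>) powr (q - 1) * (real (m + 2) * real (m + 1) * ((\<phi> t + \<delta>) powr (m / (m + 2)) * (B + \<delta>) powr q))"
      using integral_abs_power_mult_square_le[OF _ Y intZ0 iY \<delta>] q
      by (intro mult_left_mono) (auto simp: \<phi>_def B_def q_def add.commute)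
    \<comment> \<open>The exponents q - 1 and m/(m+2) cancel, so the bound no longer depends on t.
      The 2 = q (m+2) is absorbed by the 1/2 of the Taylor remainder, which leaves the constant m +
      1.\<close>
    also have "\<dots> = 2 * (m + 1) * (B + \<delta>) powr q"
    proof -
      have "q - 1 = - (m / (m + 2))" by (simp add: q_def divide_simps)
      then have "(\<phi> t + \<delta>) powr (q - 1) * (\<phi> t + \<delta>) powr (m / (m + 2)) = 1"
        using pos[of t] by (simp add: powr_minus)
      moreover have "q * real (m + 2) = 2"
      proof -
        have "real m + 2 \<noteq> 0" by linarith
        then have "q * (real m + 2) = 2" using nonzero_eq_divide_eq[of "real m + 2" q 2] q_def by blast
        then show ?thesis by (simp only: of_nat_add of_nat_numeral)
      qed
      moreover have "q * (\<phi> t + \<delta>) powr (q - 1) * (real (m + 2) * real (m + 1) * ((\<phi> t + \<delta>) powr (m / (m + 2)) * (B + \<delta>) powr q))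
          = (q * real (m + 2)) * real (m + 1) * ((\<phi> t + \<delta>) powr (q - 1) * (\<phi> t + \<delta>) powr (m / (m + 2))) * (B + \<delta>) powr q"
        by (simp only: mult_ac)
      ultimately show ?thesis by simp
    qed
    finally have "\<psi>'' t / 2 \<le> (m + 1) * (B + \<delta>) powr q" by (simp add: algebra_simps)
    moreover have "\<psi>' 0 = 0" by (simp add: \<psi>'_def \<phi>'0)
    ultimately show ?thesis using t by (simp add: \<psi>_def)
  qed
  \<comment> \<open>Since q > 0, the power is continuous up to base 0, so the shift can be removed
    even when a norm vanishes.\<close>
  have lim: "((\<lambda>\<delta>. (c + \<delta>) powr q) \<longlongrightarrow> c powr q) (at_right 0)" if "0 \<le> c" for c
  proof -
    have "((\<lambda>\<delta>. (c + \<delta>) powr q) \<longlongrightarrow> (c + 0) powr q) (at_right 0)"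
      using q that
      by (intro tendsto_powr' tendsto_intros) (auto simp: eventually_at_right_less intro!: eventually_at_rightI[of 0 1])
    then show ?thesis by simp
  qed
  have "\<phi> 1 powr q \<le> \<phi> 0 powr q + (m + 1) * B powr q"
  proof (rule tendsto_le)
    show "((\<lambda>\<delta>. (\<phi> 0 + \<delta>) powr q + (m + 1) * (B + \<delta>) powr q) \<longlongrightarrow> \<phi> 0 powr q + (m + 1) * B powr q) (at_right 0)"
      by (intro tendsto_intros lim \<phi>0 B0)
    show "((\<lambda>\<delta>. (\<phi> 1 + \<delta>) powr q) \<longlongrightarrow> \<phi> 1 powr q) (at_right 0)"
      by (intro lim \<phi>0)
    show "\<forall>\<^sub>F \<delta> in at_right 0. (\<phi> 1 + \<delta>) powr q \<le> (\<phi> 0 + \<delta>) powr q + (m + 1) * (B + \<delta>) powr q"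
      using main by (intro eventually_at_rightI[of 0 1]) auto
  qed simp
  then show ?thesis by (simp add: \<phi>_def B_def q_def Z_def add.commute)
qed

text \<open>Jensen's inequality for the average of the positive terms. Zero terms contribute to
  neither side, and counting them in \<open>card S\<close> only enlarges the bound because r - 1
  \<ge> 0.\<close>

lemma sum_powr_le:
  fixes u :: "'i \<Rightarrow> real"
  assumes "finite S" and u: "\<And>k. k \<in> S \<Longrightarrow> 0 \<le> u k" and r: "1 \<le> r"
  shows "(\<Sum>k\<in>S. u k) powr r \<le> real (card S) powr (r - 1) * (\<Sum>k\<in>S. u k powr r)"
proof -
  define P where "P = {k \<in> S. 0 < u k}"
  have fin: "finite P" and PS: "P \<subseteq> S" using \<open>finite S\<close> by (auto simp: P_def)
  have z: "u k = 0" if "k \<in> S - P" for k using u[of k] that by (auto simp: P_def)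
  have s1: "(\<Sum>k\<in>S. u k) = (\<Sum>k\<in>P. u k)"
    by (rule sum.mono_neutral_right) (use \<open>finite S\<close> PS z in auto)
  have s2: "(\<Sum>k\<in>S. u k powr r) = (\<Sum>k\<in>P. u k powr r)"
    by (rule sum.mono_neutral_right) (use \<open>finite S\<close> PS z in auto)
  show ?thesis
  proof (cases "P = {}")
    case True
    then show ?thesis by (simp add: s1 s2)
  next
    case False
    define c where "c = real (card P)"
    have c: "0 < c" using False fin by (simp add: c_def card_gt_0_iff)
    have pos: "0 < (\<Sum>k\<in>P. u k)" using False fin by (intro sum_pos) (auto simp: P_def)
    have "(\<Sum>k\<in>P. (1 / c) *\<^sub>R u k) powr r \<le> (\<Sum>k\<in>P. (1 / c) * u k powr r)"
      by (rule convex_on_sum[OF fin False powr_convex[OF r]]) (use c in \<open>auto simp: P_def c_def\<close>)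
    then have "((\<Sum>k\<in>P. u k) / c) powr r \<le> (\<Sum>k\<in>P. u k powr r) / c"
      by (simp add: sum_distrib_left[symmetric] sum_divide_distrib[symmetric])
    then have "(\<Sum>k\<in>P. u k) powr r \<le> c powr r * ((\<Sum>k\<in>P. u k powr r) / c)"
      using c by (simp add: powr_divide pos_divide_le_eq mult.commute)
    also have "\<dots> = c powr (r - 1) * (\<Sum>k\<in>P. u k powr r)"
      using c by (simp add: powr_diff)
    also have "\<dots> \<le> real (card S) powr (r - 1) * (\<Sum>k\<in>P. u k powr r)"
      using r c card_mono[OF \<open>finite S\<close> PS]
      by (intro mult_right_mono powr_mono2 sum_nonneg) (auto simp: c_def)
    finally show ?thesis by (simp add: s1 s2)
  qed
qed

text \<open>Starting from T_0 = 0, each increment adds m + 1 times its squared norm. Integrability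
  of |T_n|^(m+2) is carried through the induction because the next addition step presupposes
  it.\<close>

lemma martingale_Lp_norm_square_le:
  fixes D :: "nat \<Rightarrow> 'a \<Rightarrow> real"
  defines "T \<equiv> \<lambda>k \<omega>. \<Sum>i=1..k. D i \<omega>"
  assumes "\<And>k. k \<in> {1..n} \<Longrightarrow> D k \<in> borel_measurable M"
    and "\<And>k. k \<in> {1..n} \<Longrightarrow> integrable M (\<lambda>\<omega>. \<bar>D k \<omega>\<bar> ^ (m + 2))"
    and "\<And>k. k < n \<Longrightarrow> (\<integral>\<omega>. (T k \<omega> * \<bar>T k \<omega>\<bar> ^ m) * D (Suc k) \<omega> \<partial>M) = 0"
  shows "integrable M (\<lambda>\<omega>. \<bar>T n \<omega>\<bar> ^ (m + 2)) \<and>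
    (\<integral>\<omega>. \<bar>T n \<omega>\<bar> ^ (m + 2) \<partial>M) powr (2 / (real m + 2))
      \<le> (real m + 1) * (\<Sum>k=1..n. (\<integral>\<omega>. \<bar>D k \<omega>\<bar> ^ (m + 2) \<partial>M) powr (2 / (real m + 2)))"
  using assms(2-)
proof (induction n)
  case 0
  then show ?case by (simp add: T_def)
next
  case (Suc n)
  have IH: "integrable M (\<lambda>\<omega>. \<bar>T n \<omega>\<bar> ^ (m + 2))"
    "(\<integral>\<omega>. \<bar>T n \<omega>\<bar> ^ (m + 2) \<partial>M) powr (2 / (real m + 2))
      \<le> (real m + 1) * (\<Sum>k=1..n. (\<integral>\<omega>. \<bar>D k \<omega>\<bar> ^ (m + 2) \<partial>M) powr (2 / (real m + 2)))"
    using Suc.IH Suc.prems by auto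
  have T: "T (Suc n) = (\<lambda>\<omega>. T n \<omega> + D (Suc n) \<omega>)" by (simp add: T_def fun_eq_iff)
  have mT[measurable]: "T n \<in> borel_measurable M"
    unfolding T_def using Suc.prems(1) by (intro borel_measurable_sum) auto
  have mD[measurable]: "D (Suc n) \<in> borel_measurable M" using Suc.prems(1) by auto
  have iD: "integrable M (\<lambda>\<omega>. \<bar>D (Suc n) \<omega>\<bar> ^ (m + 2))" using Suc.prems(2) by auto
  have "integrable M (\<lambda>\<omega>. \<bar>T n \<omega> + D (Suc n) \<omega>\<bar> ^ (m + 2))"
  proof (rule Bochner_Integration.integrable_bound[OF integrable_abs_power_sum[OF mT mD IH(1) iD, of 1]])
    show "AE \<omega> in M. norm (\<bar>T n \<omega> + D (Suc n) \<omega>\<bar> ^ (m + 2)) \<le> norm ((\<bar>T n \<omega>\<bar> + 1 * \<bar>D (Suc n) \<omega>\<bar>) ^ (m + 2))"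
    proof (rule AE_I2)
      fix \<omega>
      have "\<bar>T n \<omega> + D (Suc n) \<omega>\<bar> ^ (m + 2) \<le> (\<bar>T n \<omega>\<bar> + 1 * \<bar>D (Suc n) \<omega>\<bar>) ^ (m + 2)"
        by (intro power_mono) auto
      then show "norm (\<bar>T n \<omega> + D (Suc n) \<omega>\<bar> ^ (m + 2)) \<le> norm ((\<bar>T n \<omega>\<bar> + 1 * \<bar>D (Suc n) \<omega>\<bar>) ^ (m + 2))"
        by (simp del: power_add power_add_numeral add_2_eq_Suc')
    qed
  qed measurable
  moreover have "(\<integral>\<omega>. (T n \<omega> * \<bar>T n \<omega>\<bar> ^ m) * D (Suc n) \<omega> \<partial>M) = 0" using Suc.prems(3)[of n] by simp
  note Lp_norm_square_add_le[OF mT mD IH(1) iD this]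
  ultimately show ?case using IH(2) unfolding T by (simp add: distrib_left)
qed

text \<open>Raising the norm inequality to the power r = (m+2)/2 and applying the power mean
  inequality trades powers of norms for plain moments, the form into which bounds on moments of H_k
  can be inserted. The cost is n^(r-1) = n^(m/2).\<close>

lemma martingale_moment_le:
  fixes D :: "nat \<Rightarrow> 'a \<Rightarrow> real"
  defines "T \<equiv> \<lambda>k \<omega>. \<Sum>i=1..k. D i \<omega>"
  assumes meas: "\<And>k. k \<in> {1..n} \<Longrightarrow> D k \<in> borel_measurable M"
    and int: "\<And>k. k \<in> {1..n} \<Longrightarrow> integrable M (\<lambda>\<omega>. \<bar>D k \<omega>\<bar> ^ (m + 2))"
    and orth: "\<And>k. k < n \<Longrightarrow> (\<integral>\<omega>. (T k \<omega> * \<bar>T k \<omega>\<bar> ^ m) * D (Suc k) \<omega> \<partial>M) = 0"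
  shows "integrable M (\<lambda>\<omega>. \<bar>T n \<omega>\<bar> ^ (m + 2))"
    and "(\<integral>\<omega>. \<bar>T n \<omega>\<bar> ^ (m + 2) \<partial>M)
      \<le> (real m + 1) powr ((real m + 2) / 2) * real n powr (real m / 2) * (\<Sum>k=1..n. \<integral>\<omega>. \<bar>D k \<omega>\<bar> ^ (m + 2) \<partial>M)"
proof -
  note * = martingale_Lp_norm_square_le[of n D M m, OF meas int orth[unfolded T_def]]
  from * show "integrable M (\<lambda>\<omega>. \<bar>T n \<omega>\<bar> ^ (m + 2))" unfolding T_def by simp
  define A where "A = (\<integral>\<omega>. \<bar>T n \<omega>\<bar> ^ (m + 2) \<partial>M)"
  define d where "d k = (\<integral>\<omega>. \<bar>D k \<omega>\<bar> ^ (m + 2) \<partial>M)" for k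
  define r where "r = (real m + 2) / 2"
  have r: "1 \<le> r" "r - 1 = real m / 2" by (auto simp: r_def field_simps)
  have q: "2 / (real m + 2) = 1 / r" by (simp add: r_def)
  have nn: "0 \<le> A" "0 \<le> d k" for k by (auto simp: A_def d_def)
  have le: "A powr (1 / r) \<le> (real m + 1) * (\<Sum>k=1..n. d k powr (1 / r))"
    using * unfolding A_def d_def T_def q by (simp add: q add.commute)
  have "A = (A powr (1 / r)) powr r" using r nn by (simp add: powr_powr)
  also have "\<dots> \<le> ((real m + 1) * (\<Sum>k=1..n. d k powr (1 / r))) powr r"
    using r le by (intro powr_mono2) auto
  also have "\<dots> = (real m + 1) powr r * (\<Sum>k=1..n. d k powr (1 / r)) powr r"
    by (simp add: powr_mult sum_nonneg)
  also have "\<dots> \<le> (real m + 1) powr r * (real (card {1..n}) powr (r - 1) * (\<Sum>k=1..n. (d k powr (1 / r)) powr r))"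
    by (intro mult_left_mono sum_powr_le r) auto
  also have "(\<Sum>k=1..n. (d k powr (1 / r)) powr r) = (\<Sum>k=1..n. d k)"
    using r nn by (intro sum.cong) (auto simp: powr_powr)
  finally have "A \<le> (real m + 1) powr r * (n powr (r - 1) * (\<Sum>k=1..n. d k))" by simp
  then show "(\<integral>\<omega>. \<bar>T n \<omega>\<bar> ^ (m + 2) \<partial>M)
      \<le> (real m + 1) powr ((real m + 2) / 2) * real n powr (real m / 2) * (\<Sum>k=1..n. \<integral>\<omega>. \<bar>D k \<omega>\<bar> ^ (m + 2) \<partial>M)"
    unfolding A_def d_def r(2) by (simp add: r_def mult.assoc add.commute)
qed

section \<open>Bernstein's inequality from moment bounds\<close>

text \<open>The exponential series bounds e^z - 1 - z by the sum of |z|^(m+2) / (m+2)!, and the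
  moment bounds turn this into a geometric series of ratio t C. The linear term disappears because
  \<open>S\<close> is centred.\<close>

lemma (in prob_space) expectation_exp_le:
  fixes S :: "'a \<Rightarrow> real"
  assumes iS: "integrable M S" and ES: "expectation S = 0"
    and mom: "\<And>m. (\<integral>\<^sup>+\<omega>. ennreal (\<bar>S \<omega>\<bar> ^ (m + 2)) \<partial>M) \<le> ennreal (1 / 2 * fact (m + 2) * C ^ m * v)"
    and C: "0 \<le> C" and v: "0 \<le> v" and t: "0 \<le> t" "t * C < 1"
  shows "integrable M (\<lambda>\<omega>. exp (t * S \<omega>))"
    and "expectation (\<lambda>\<omega>. exp (t * S \<omega>)) \<le> 1 + t\<^sup>2 * v / (2 * (1 - t * C))"
proof -
  have [measurable]: "S \<in> borel_measurable M" using iS by auto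
  define R where "R = t\<^sup>2 * v / (2 * (1 - t * C))"
  have R0: "0 \<le> R" unfolding R_def using t v by simp
  define g where "g \<omega> = exp (t * S \<omega>) - 1 - t * S \<omega>" for \<omega>
  have g0: "0 \<le> g \<omega>" for \<omega>
    unfolding g_def using exp_ge_add_one_self[of "t * S \<omega>"] by linarith
  have [measurable]: "g \<in> borel_measurable M" unfolding g_def by measurable
  have pw: "ennreal (g \<omega>) \<le> (\<Sum>m. ennreal (t ^ (m + 2) / fact (m + 2)) * ennreal (\<bar>S \<omega>\<bar> ^ (m + 2)))" for \<omega>
  proof -
    define z where "z = t * S \<omega>"
    have sm: "summable (\<lambda>m. inverse (fact (m + 2)) *\<^sub>R (z ^ (m + 2)))" for z :: real
      using summable_exp_generic[of z] by (subst summable_iff_shift[of "\<lambda>n. inverse (fact n) *\<^sub>R (z ^ n)"])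
    have "g \<omega> = (\<Sum>m. inverse (fact (m + 2)) *\<^sub>R (z ^ (m + 2)))"
      using exp_first_two_terms[of z] by (simp add: g_def z_def)
    also have "\<dots> \<le> (\<Sum>m. inverse (fact (m + 2)) *\<^sub>R (\<bar>z\<bar> ^ (m + 2)))"
    proof (rule suminf_le[OF _ sm sm])
      show "inverse (fact (m + 2)) *\<^sub>R z ^ (m + 2) \<le> inverse (fact (m + 2)) *\<^sub>R \<bar>z\<bar> ^ (m + 2)" for m
        by (intro scaleR_left_mono) (auto simp del: power_add_numeral add_2_eq_Suc' simp flip: power_abs)
    qed
    finally have "ennreal (g \<omega>) \<le> ennreal (\<Sum>m. inverse (fact (m + 2)) *\<^sub>R (\<bar>z\<bar> ^ (m + 2)))"
      by (rule ennreal_leI)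
    also have "\<dots> = (\<Sum>m. ennreal (inverse (fact (m + 2)) *\<^sub>R (\<bar>z\<bar> ^ (m + 2))))"
      by (rule suminf_ennreal2[symmetric, OF _ sm]) simp
    also have "\<dots> = (\<Sum>m. ennreal (t ^ (m + 2) / fact (m + 2)) * ennreal (\<bar>S \<omega>\<bar> ^ (m + 2)))"
    proof (rule suminf_cong)
      fix m
      have "inverse (fact (m + 2)) *\<^sub>R (\<bar>z\<bar> ^ (m + 2)) = t ^ (m + 2) / fact (m + 2) * \<bar>S \<omega>\<bar> ^ (m + 2)"
        using t by (simp only: z_def abs_mult power_mult_distrib abs_of_nonneg) (simp add: divide_inverse mult_ac)
      then show "ennreal (inverse (fact (m + 2)) *\<^sub>R (\<bar>z\<bar> ^ (m + 2))) = ennreal (t ^ (m + 2) / fact (m + 2)) * ennreal (\<bar>S \<omega>\<bar> ^ (m + 2))"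
        using t by (simp only:) (rule ennreal_mult, auto)
    qed
    finally show ?thesis .
  qed
  \<comment> \<open>In \<open>ennreal\<close> the series may be integrated termwise without prior
    integrability; the finite value of the result is what then proves \<open>g\<close>, and with it
    the exponential, integrable.\<close>
  have "(\<integral>\<^sup>+\<omega>. ennreal (g \<omega>) \<partial>M) \<le> (\<integral>\<^sup>+\<omega>. (\<Sum>m. ennreal (t ^ (m + 2) / fact (m + 2)) * ennreal (\<bar>S \<omega>\<bar> ^ (m + 2))) \<partial>M)"
    by (intro nn_integral_mono pw)
  also have "\<dots> = (\<Sum>m. ennreal (t ^ (m + 2) / fact (m + 2)) * (\<integral>\<^sup>+\<omega>. ennreal (\<bar>S \<omega>\<bar> ^ (m + 2)) \<partial>M))"
    by (subst nn_integral_suminf) (measurable, intro suminf_cong nn_integral_cmult, measurable)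
  also have "\<dots> \<le> (\<Sum>m. ennreal (1 / 2 * t\<^sup>2 * v * (t * C) ^ m))"
  proof (rule suminf_le)
    fix m
    have "ennreal (t ^ (m + 2) / fact (m + 2)) * (\<integral>\<^sup>+\<omega>. ennreal (\<bar>S \<omega>\<bar> ^ (m + 2)) \<partial>M)
        \<le> ennreal (t ^ (m + 2) / fact (m + 2)) * ennreal (1 / 2 * fact (m + 2) * C ^ m * v)"
      by (intro mult_left_mono mom) simp
    also have "\<dots> = ennreal (t ^ (m + 2) / fact (m + 2) * (1 / 2 * fact (m + 2) * C ^ m * v))"
      using t C v by (intro ennreal_mult[symmetric]) auto
    also have "t ^ (m + 2) / fact (m + 2) * (1 / 2 * fact (m + 2) * C ^ m * v) = 1 / 2 * t\<^sup>2 * v * (t * C) ^ m"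
      by (simp add: power_mult_distrib power_add del: fact_Suc add_2_eq_Suc')
    finally show "ennreal (t ^ (m + 2) / fact (m + 2)) * (\<integral>\<^sup>+\<omega>. ennreal (\<bar>S \<omega>\<bar> ^ (m + 2)) \<partial>M)
        \<le> ennreal (1 / 2 * t\<^sup>2 * v * (t * C) ^ m)" .
  qed auto
  also have "\<dots> = ennreal (\<Sum>m. 1 / 2 * t\<^sup>2 * v * (t * C) ^ m)"
    using t C v by (intro suminf_ennreal2 summable_mult summable_geometric) auto
  also have "(\<Sum>m. 1 / 2 * t\<^sup>2 * v * (t * C) ^ m) = R"
    using t C by (subst suminf_mult) (auto simp: suminf_geometric R_def intro!: summable_geometric)
  finally have nn: "(\<integral>\<^sup>+\<omega>. ennreal (g \<omega>) \<partial>M) \<le> ennreal R" .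
  have ig: "integrable M g"
    using nn g0 by (intro integrableI_nonneg) (auto intro: le_less_trans)
  have "ennreal (expectation g) \<le> ennreal R"
    using nn nn_integral_eq_integral[OF ig] g0 by simp
  then have Eg: "expectation g \<le> R" using R0 by simp
  have e: "(\<lambda>\<omega>. exp (t * S \<omega>)) = (\<lambda>\<omega>. g \<omega> + (1 + t * S \<omega>))" by (simp add: g_def fun_eq_iff)
  show "integrable M (\<lambda>\<omega>. exp (t * S \<omega>))"
    unfolding e using ig iS by (intro Bochner_Integration.integrable_add integrable_mult_right) auto
  show "expectation (\<lambda>\<omega>. exp (t * S \<omega>)) \<le> 1 + t\<^sup>2 * v / (2 * (1 - t * C))"
    unfolding e using ig iS ES Eg by (simp add: prob_space R_def)
qed

lemma (in prob_space) bernstein_inequality: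
  fixes S :: "'a \<Rightarrow> real"
  assumes iS: "integrable M S" and ES: "expectation S = 0"
    and mom: "\<And>m. (\<integral>\<^sup>+\<omega>. ennreal (\<bar>S \<omega>\<bar> ^ (m + 2)) \<partial>M) \<le> ennreal (1 / 2 * fact (m + 2) * C ^ m * V\<^sup>2)"
    and C: "0 < C" and V: "0 < V" and x: "0 < x"
  shows "prob {\<omega> \<in> space M. S \<omega> \<ge> x * V} \<le> exp (- x\<^sup>2 / (1 + sqrt (1 + 2 * (x * C / V)) + x * C / V))"
proof -
  have [measurable]: "S \<in> borel_measurable M" using iS by auto
  define b where "b = x * C / V"
  have b: "0 < b" using x C V by (simp add: b_def)
  define r where "r = sqrt (1 + 2 * b)"
  have r: "1 < r" using b by (simp add: r_def)
  have r2: "b = (r\<^sup>2 - 1) / 2" using b by (simp add: r_def)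
  \<comment> \<open>The minimiser of t^2 V^2 / (2 (1 - t C)) - t x V: with u = 1 - t C, stationarity
    reads 1/u^2 = 1 + 2 b, so u = 1/r.\<close>
  define t where "t = (1 - 1 / r) / C"
  have t: "0 < t" "t * C = 1 - 1 / r" using r C by (auto simp: t_def)
  have tC: "t * C < 1" using r t by simp
  note mgf = expectation_exp_le[OF iS ES mom less_imp_le[OF C] zero_le_power2 less_imp_le[OF t(1)] tC]
  have "{\<omega> \<in> space M. S \<omega> \<ge> x * V} = {\<omega> \<in> space M. exp (t * S \<omega>) \<ge> exp (t * (x * V))}"
    using t by auto
  then have "prob {\<omega> \<in> space M. S \<omega> \<ge> x * V} \<le> expectation (\<lambda>\<omega>. exp (t * S \<omega>)) / exp (t * (x * V))"
    using mgf(1) by (simp only:) (rule integral_Markov_inequality_measure[where A = "{}"], auto)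
  also have "\<dots> \<le> exp (t\<^sup>2 * V\<^sup>2 / (2 * (1 - t * C))) / exp (t * (x * V))"
    using mgf(2) exp_ge_add_one_self[of "t\<^sup>2 * V\<^sup>2 / (2 * (1 - t * C))"]
    by (intro divide_right_mono order.trans[OF mgf(2)]) simp_all
  also have "\<dots> = exp (t\<^sup>2 * V\<^sup>2 / (2 * (1 - t * C)) - t * (x * V))" by (simp add: exp_diff)
  also have "t\<^sup>2 * V\<^sup>2 / (2 * (1 - t * C)) - t * (x * V) = - x\<^sup>2 / (1 + r + b)"
  proof -
    have "t * V = x * (r - 1) / (r * b)"
    proof -
      have C_eq: "C = b * V / x" using x V by (simp add: b_def)
      show ?thesis unfolding t_def C_eq using r x V b by (simp add: field_simps)
    qed
    also have "\<dots> = 2 * x / (r * (r + 1))"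
    proof -
      have "r * b \<noteq> 0" "r * (r + 1) \<noteq> 0" using r b by auto
      then show ?thesis unfolding r2 by (subst frac_eq_eq) (simp_all add: power2_eq_square algebra_simps)
    qed
    finally have tV: "t * V = 2 * x / (r * (r + 1))" .
    have "t\<^sup>2 * V\<^sup>2 / (2 * (1 - t * C)) - t * (x * V) = (t * V)\<^sup>2 * r / 2 - x * (t * V)"
      by (simp add: t(2) power_mult_distrib)
    also have "\<dots> = - 2 * x\<^sup>2 / (r + 1)\<^sup>2"
      unfolding tV using r by (simp add: divide_simps) algebra
    also have "\<dots> = - x\<^sup>2 / (1 + r + b)"
    proof -
      \<comment> \<open>Because 2 b = r^2 - 1, the denominator of the claim is half a perfect
        square, which matches the minimal value -2 x^2 / (r+1)^2.\<close>
      have eq: "1 + r + b = (r + 1)\<^sup>2 / 2" unfolding r2 by (simp add: power2_eq_square field_simps)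
      show ?thesis unfolding eq by simp
    qed
    finally show ?thesis .
  qed
  finally show ?thesis by (simp add: r_def b_def)
qed

section \<open>Chains driven by independent innovations\<close>

text \<open>Since \<open>lip_coef a 0 = 1\<close>, letting the sum start at l = 0 absorbs the
  separate term a_k. The recursion becomes uniform and also covers k = 0.\<close>

lemma lip_coef_eq: "lip_coef a k = 1 + (\<Sum>l<k. lip_coef a l * a (k - l))"
proof (cases k)
  case (Suc k)
  have "(\<Sum>l<Suc k. lip_coef a l * a (Suc k - l)) = a (Suc k) + (\<Sum>l<k. lip_coef a (Suc l) * a (k - l))"
    by (subst sum.lessThan_Suc_shift) (simp del: lip_coef.simps(2))
  also have "(\<Sum>l<k. lip_coef a (Suc l) * a (k - l)) = (\<Sum>l=1..k. lip_coef a l * a (Suc k - l))"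
    by (rule sum.reindex_bij_witness[of _ "\<lambda>l. l - 1" Suc]) auto
  finally show ?thesis using Suc by simp
qed simp

context
  fixes a :: "nat \<Rightarrow> real"
  assumes a: "\<And>i. i \<ge> 1 \<Longrightarrow> a i \<ge> 0"
begin

lemma lip_coef_ge_1: "1 \<le> lip_coef a k"
proof (induction k rule: less_induct)
  case (less k)
  have "0 \<le> (\<Sum>l<k. lip_coef a l * a (k - l))"
    by (intro sum_nonneg mult_nonneg_nonneg a) (use less in \<open>force+\<close>)
  then show ?case by (subst lip_coef_eq) simp
qed

text \<open>After shifting the index by one, the recursion for k + 1 has the same coefficients as
  that for k, applied to later values of \<open>lip_coef\<close>, plus the nonnegative term
  a_{k+1}.\<close>

lemma lip_coef_Suc_ge: "lip_coef a k \<le> lip_coef a (Suc k)"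
proof (induction k rule: less_induct)
  case (less k)
  have "(\<Sum>l<k. lip_coef a l * a (k - l)) \<le> (\<Sum>l<k. lip_coef a (Suc l) * a (k - l))"
    by (intro sum_mono mult_right_mono less a) auto
  also have "\<dots> \<le> (\<Sum>l<Suc k. lip_coef a l * a (Suc k - l))"
    using a[of "Suc k"] by (simp add: sum.lessThan_Suc_shift del: sum.lessThan_Suc)
  finally show ?case by (subst (1 2) lip_coef_eq) simp
qed

lemma lip_coef_mono: "k \<le> l \<Longrightarrow> lip_coef a k \<le> lip_coef a l"
  by (rule lift_Suc_mono_le[of "lip_coef a"]) (rule lip_coef_Suc_ge)

end

text \<open>Measurability of f is not among the hypotheses; it follows from continuity in the
  product topology, whose Borel sets form the product sigma-algebra on a countable power of a second
  countable space.\<close>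

lemma borel_measurable_separately_Lipschitz:
  fixes g :: "(nat \<Rightarrow> 'x::polish_space) \<Rightarrow> real"
  assumes I: "finite I" and L: "\<And>u u'. \<bar>g u - g u'\<bar> \<le> (\<Sum>i\<in>I. c i * dist (u i) (u' i))"
  shows "g \<in> borel_measurable (\<Pi>\<^sub>M j\<in>UNIV. borel)"
proof -
  have "isCont g u" for u
    unfolding isCont_def
  proof (rule Lim_null[THEN iffD2], rule Lim_null_comparison)
    show "\<forall>\<^sub>F v in at u. norm (g v - g u) \<le> (\<Sum>i\<in>I. c i * dist (v i) (u i))"
      using L by (intro always_eventually) auto
    have "continuous_on UNIV (\<lambda>v :: nat \<Rightarrow> 'x. v i)" for i
      by (rule continuous_on_product_coordinates)
    then have "((\<lambda>v. v i) \<longlongrightarrow> u i) (at u)" for i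
      unfolding continuous_on_eq_continuous_at[OF open_UNIV] isCont_def by blast
    then have "((\<lambda>v. dist (v i) (u i)) \<longlongrightarrow> 0) (at u)" for i
      by (rule tendsto_dist_iff[THEN iffD1])
    then have "((\<lambda>v. \<Sum>i\<in>I. c i * dist (v i) (u i)) \<longlongrightarrow> (\<Sum>i\<in>I. c i * 0)) (at u)"
      by (intro tendsto_intros)
    then show "((\<lambda>v. \<Sum>i\<in>I. c i * dist (v i) (u i)) \<longlongrightarrow> 0) (at u)" by simp
  qed
  then have "g \<in> borel_measurable borel"
    by (intro borel_measurable_continuous_onI continuous_at_imp_continuous_on) auto
  then show ?thesis
    using measurable_cong_sets[OF sets_PiM_equal_borel refl] by blast
qed

section \<open>Finite trajectories and their independence of the next innovation\<close>

locale driven_chain = prob_space M for M :: "'w measure" +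
  fixes noise :: "nat \<Rightarrow> 'w \<Rightarrow> 'y::polish_space"
    and F :: "nat \<Rightarrow> (nat \<Rightarrow> 'x::polish_space) \<times> 'y \<Rightarrow> 'x"
    and X :: "int \<Rightarrow> 'w \<Rightarrow> 'x"
    and x0 :: "int \<Rightarrow> 'x"
  assumes indep: "indep_vars (\<lambda>_. borel) noise {1..}"
    and F_meas: "\<And>m. m \<ge> 1 \<Longrightarrow> F m \<in> ((\<Pi>\<^sub>M j\<in>UNIV. borel) \<Otimes>\<^sub>M borel) \<rightarrow>\<^sub>M borel"
    and X_init: "\<And>i \<omega>. i \<le> 0 \<Longrightarrow> \<omega> \<in> space M \<Longrightarrow> X i \<omega> = x0 i"
    and X_step: "\<And>m \<omega>. m \<ge> 1 \<Longrightarrow> \<omega> \<in> space M \<Longrightarrow> X (int m) \<omega> = F m (past X m \<omega>, noise m \<omega>)"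
begin

abbreviation PX :: "(nat \<Rightarrow> 'x) measure" where "PX \<equiv> (\<Pi>\<^sub>M j\<in>UNIV. borel)"

abbreviation P :: "nat \<Rightarrow> 'y measure" where "P k \<equiv> distr M borel (noise k)"

text \<open>
  A finite trajectory $(x_1, x_2, \ldots)$ is stored as \<open>w :: nat \<Rightarrow> 'x\<close>; only the coordinates
  \<open>1..k-1\<close> matter for the step at time \<open>k\<close>.
\<close>

definition hist :: "nat \<Rightarrow> (nat \<Rightarrow> 'x) \<Rightarrow> nat \<Rightarrow> 'x" where
  "hist k w = (\<lambda>j. if Suc j < k then w (k - Suc j) else x0 (int k - int (Suc j)))"

definition step :: "nat \<Rightarrow> (nat \<Rightarrow> 'x) \<Rightarrow> 'y \<Rightarrow> nat \<Rightarrow> 'x" where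
  "step k w y = w(k := F k (hist k w, y))"

text \<open>Coordinates outside 1..k are padded with the fixed point \<open>x0 0\<close>. Thus
  \<open>traj 0\<close> is constant, and passing from k to k + 1 is exactly one
  \<open>step\<close>.\<close>

definition traj :: "nat \<Rightarrow> 'w \<Rightarrow> nat \<Rightarrow> 'x" where
  "traj k \<omega> = (\<lambda>i. if 1 \<le> i \<and> i \<le> k then X (int i) \<omega> else x0 0)"

lemma past_eq_hist:
  assumes "\<omega> \<in> space M"
  shows "past X (Suc k) \<omega> = hist (Suc k) (traj k \<omega>)"
proof
  fix j
  show "past X (Suc k) \<omega> j = hist (Suc k) (traj k \<omega>) j"
    using X_init[of "int (Suc k) - int (Suc j)", OF _ assms]
    by (auto simp: past_def hist_def traj_def of_nat_diff)
qed

lemma traj_Suc: "\<omega> \<in> space M \<Longrightarrow> traj (Suc k) \<omega> = step (Suc k) (traj k \<omega>) (noise (Suc k) \<omega>)"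
  using X_step[of "Suc k" \<omega>] by (auto simp: step_def past_eq_hist fun_eq_iff) (auto simp: traj_def)

lemma noise_measurable[measurable]: "1 \<le> k \<Longrightarrow> noise k \<in> M \<rightarrow>\<^sub>M borel"
  using indep by (auto simp: indep_vars_def)

lemma prob_space_noise: "1 \<le> k \<Longrightarrow> prob_space (P k)"
  by (rule prob_space_distr) measurable

lemma hist_measurable[measurable]: "hist k \<in> PX \<rightarrow>\<^sub>M PX"
  unfolding hist_def by (rule measurable_PiM_single') auto

lemma F_hist_measurable[measurable]:
  assumes "1 \<le> k" and [measurable]: "f \<in> N \<rightarrow>\<^sub>M PX" "g \<in> N \<rightarrow>\<^sub>M borel"
  shows "(\<lambda>z. F k (hist k (f z), g z)) \<in> N \<rightarrow>\<^sub>M borel"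
  by (rule measurable_compose[OF _ F_meas[OF assms(1)]]) measurable

lemma step_measurable[measurable]:
  assumes k: "1 \<le> k" and [measurable]: "f \<in> N \<rightarrow>\<^sub>M PX" "g \<in> N \<rightarrow>\<^sub>M borel"
  shows "(\<lambda>z. step k (f z) (g z)) \<in> N \<rightarrow>\<^sub>M PX"
proof (rule measurable_PiM_single')
  show "(\<lambda>z. step k (f z) (g z) i) \<in> N \<rightarrow>\<^sub>M borel" for i
    using k unfolding step_def by (cases "i = k") simp_all
qed auto

text \<open>This turns independence of the innovations into independence of the trajectory up to k
  and the innovation k + 1; measurability of the trajectory follows as well.\<close>

lemma traj_factor:
  "\<exists>\<Phi> \<in> (\<Pi>\<^sub>M i\<in>{1..k}. borel) \<rightarrow>\<^sub>M PX. \<forall>\<omega>\<in>space M. traj k \<omega> = \<Phi> (restrict (\<lambda>i. noise i \<omega>) {1..k})"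
proof (induction k)
  case 0
  show ?case
    by (rule bexI[of _ "\<lambda>_ _. x0 0"]) (auto simp: traj_def fun_eq_iff intro!: measurable_PiM_single')
next
  case (Suc k)
  then obtain \<Phi> where [measurable]: "\<Phi> \<in> (\<Pi>\<^sub>M i\<in>{1..k}. borel) \<rightarrow>\<^sub>M PX"
    and \<Phi>: "\<And>\<omega>. \<omega> \<in> space M \<Longrightarrow> traj k \<omega> = \<Phi> (restrict (\<lambda>i. noise i \<omega>) {1..k})" by blast
  have [measurable]: "(\<lambda>e. restrict e {1..k}) \<in> (\<Pi>\<^sub>M i\<in>{1..Suc k}. borel) \<rightarrow>\<^sub>M (\<Pi>\<^sub>M i\<in>{1..k}. borel :: 'y measure)"
    by (rule measurable_restrict_subset) auto
  have [measurable]: "(\<lambda>e. e (Suc k)) \<in> (\<Pi>\<^sub>M i\<in>{1..Suc k}. borel) \<rightarrow>\<^sub>M (borel :: 'y measure)"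
    by (rule measurable_component_singleton) simp
  show ?case
  proof (rule bexI[of _ "\<lambda>e. step (Suc k) (\<Phi> (restrict e {1..k})) (e (Suc k))"], intro ballI)
    fix \<omega> assume "\<omega> \<in> space M"
    moreover have "restrict (restrict (\<lambda>i. noise i \<omega>) {1..Suc k}) {1..k} = restrict (\<lambda>i. noise i \<omega>) {1..k}"
      by (auto simp: fun_eq_iff restrict_def)
    ultimately show "traj (Suc k) \<omega> = step (Suc k) (\<Phi> (restrict (restrict (\<lambda>i. noise i \<omega>) {1..Suc k}) {1..k}))
        (restrict (\<lambda>i. noise i \<omega>) {1..Suc k} (Suc k))"
      by (simp add: traj_Suc \<Phi>)
  qed measurable
qed

lemma traj_measurable[measurable]: "traj k \<in> M \<rightarrow>\<^sub>M PX"
proof -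
  obtain \<Phi> where [measurable]: "\<Phi> \<in> (\<Pi>\<^sub>M i\<in>{1..k}. borel) \<rightarrow>\<^sub>M PX"
    and \<Phi>: "\<And>\<omega>. \<omega> \<in> space M \<Longrightarrow> traj k \<omega> = \<Phi> (restrict (\<lambda>i. noise i \<omega>) {1..k})"
    using traj_factor by blast
  have [measurable]: "(\<lambda>\<omega>. restrict (\<lambda>i. noise i \<omega>) {1..k}) \<in> M \<rightarrow>\<^sub>M (\<Pi>\<^sub>M i\<in>{1..k}. borel)"
    by (intro measurable_restrict) auto
  have "(\<lambda>\<omega>. \<Phi> (restrict (\<lambda>i. noise i \<omega>) {1..k})) \<in> M \<rightarrow>\<^sub>M PX" by measurable
  then show ?thesis using \<Phi> by (subst measurable_cong) auto
qed

text \<open>The innovation blocks 1..k and {k+1} are independent, and the trajectory and the next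
  innovation are measurable images of one block each. The product law is therefore pushed forward
  from the blocks.\<close>

lemma distr_traj_noise:
  "distr M (PX \<Otimes>\<^sub>M borel) (\<lambda>\<omega>. (traj k \<omega>, noise (Suc k) \<omega>)) = distr M PX (traj k) \<Otimes>\<^sub>M P (Suc k)"
proof -
  obtain \<Phi> where \<Phi>m[measurable]: "\<Phi> \<in> (\<Pi>\<^sub>M i\<in>{1..k}. borel) \<rightarrow>\<^sub>M PX"
    and \<Phi>: "\<And>\<omega>. \<omega> \<in> space M \<Longrightarrow> traj k \<omega> = \<Phi> (restrict (\<lambda>i. noise i \<omega>) {1..k})"
    using traj_factor by blast
  define R where "R A \<omega> = restrict (\<lambda>i. noise i \<omega>) A" for A \<omega>
  let ?B = "\<lambda>A. \<Pi>\<^sub>M i\<in>A. borel :: 'y measure"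
  have [measurable]: "R {1..k} \<in> M \<rightarrow>\<^sub>M ?B {1..k}" "R {Suc k} \<in> M \<rightarrow>\<^sub>M ?B {Suc k}"
    unfolding R_def by (intro measurable_restrict; simp)+
  have [measurable]: "(\<lambda>e. e (Suc k)) \<in> ?B {Suc k} \<rightarrow>\<^sub>M borel"
    by (rule measurable_component_singleton) simp
  have d1: "distr M PX (traj k) = distr (distr M (?B {1..k}) (R {1..k})) PX \<Phi>"
    by (subst distr_distr) (auto intro!: distr_cong simp: \<Phi> R_def simp del: One_nat_def)
  have d2: "P (Suc k) = distr (distr M (?B {Suc k}) (R {Suc k})) borel (\<lambda>e. e (Suc k))"
    by (subst distr_distr) (auto intro!: distr_cong simp: R_def)
  have "indep_var (?B {1..k}) (R {1..k}) (?B {Suc k}) (R {Suc k})"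
    unfolding R_def by (rule indep_var_restrict[OF indep]) auto
  then have *: "distr M (?B {1..k}) (R {1..k}) \<Otimes>\<^sub>M distr M (?B {Suc k}) (R {Suc k})
      = distr M (?B {1..k} \<Otimes>\<^sub>M ?B {Suc k}) (\<lambda>\<omega>. (R {1..k} \<omega>, R {Suc k} \<omega>))"
    unfolding indep_var_distribution_eq by simp
  interpret Q: prob_space "P (Suc k)" by (rule prob_space_noise) simp
  have "distr M PX (traj k) \<Otimes>\<^sub>M P (Suc k)
      = distr (distr M (?B {1..k}) (R {1..k}) \<Otimes>\<^sub>M distr M (?B {Suc k}) (R {Suc k}))
          (PX \<Otimes>\<^sub>M borel) (\<lambda>(e, e'). (\<Phi> e, e' (Suc k)))"
    unfolding d1 d2
    by (rule pair_measure_distr) (measurable, use Q.sigma_finite_measure_axioms d2 in simp)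
  also have "\<dots> = distr M (PX \<Otimes>\<^sub>M borel) (\<lambda>\<omega>. (traj k \<omega>, noise (Suc k) \<omega>))"
    unfolding * by (subst distr_distr) (auto intro!: distr_cong simp: \<Phi> R_def simp del: One_nat_def)
  finally show ?thesis by simp
qed

text \<open>If \<open>h\<close> is not integrable, the left-hand side is the junk value $0$.\<close>

lemma integral_increment_eq_0:
  fixes h :: "(nat \<Rightarrow> 'x) \<times> 'y \<Rightarrow> real"
  assumes [measurable]: "h \<in> borel_measurable (PX \<Otimes>\<^sub>M borel)"
    and zero: "\<And>w. (\<integral>y. h (w, y) \<partial>P (Suc k)) = 0"
  shows "(\<integral>\<omega>. h (traj k \<omega>, noise (Suc k) \<omega>) \<partial>M) = 0"
proof -
  interpret Q: prob_space "P (Suc k)" by (rule prob_space_noise) simp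
  interpret T: prob_space "distr M PX (traj k)" by (rule prob_space_distr) measurable
  interpret pair_prob_space "distr M PX (traj k)" "P (Suc k)" ..
  have "(\<integral>\<omega>. h (traj k \<omega>, noise (Suc k) \<omega>) \<partial>M)
      = integral\<^sup>L (distr M (PX \<Otimes>\<^sub>M borel) (\<lambda>\<omega>. (traj k \<omega>, noise (Suc k) \<omega>))) h"
    by (subst integral_distr) auto
  also have "\<dots> = 0"
    unfolding distr_traj_noise
  proof (cases "integrable (distr M PX (traj k) \<Otimes>\<^sub>M P (Suc k)) h")
    case True
    from integral_fst'[OF this] show "integral\<^sup>L (distr M PX (traj k) \<Otimes>\<^sub>M P (Suc k)) h = 0"
      by (simp add: zero)
  qed (rule not_integrable_integral_eq)
  finally show ?thesis .
qed

end

section \<open>Oscillation of one step and contraction along finite histories\<close>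

locale contractive_chain = driven_chain M noise F X x0
  for M :: "'w measure"
    and noise :: "nat \<Rightarrow> 'w \<Rightarrow> 'y::polish_space"
    and F :: "nat \<Rightarrow> (nat \<Rightarrow> 'x::polish_space) \<times> 'y \<Rightarrow> 'x"
    and X :: "int \<Rightarrow> 'w \<Rightarrow> 'x"
    and x0 :: "int \<Rightarrow> 'x" +
  fixes a :: "nat \<Rightarrow> real" and n :: nat
  assumes a_nonneg: "\<And>i. i \<ge> 1 \<Longrightarrow> a i \<ge> 0"
    and contraction: "\<And>m u u'. m \<ge> 1 \<Longrightarrow>
           (\<integral>\<^sup>+ \<omega>. ennreal (dist (F m (u, noise m \<omega>)) (F m (u', noise m \<omega>))) \<partial>M)
             \<le> (\<Sum>j. ennreal (a (Suc j) * dist (u j) (u' j)))"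
    and H_var_L2: "\<And>k. k \<in> {1..n} \<Longrightarrow> (\<integral>\<^sup>+ \<omega>. (H_var M F noise X k \<omega>)\<^sup>2 \<partial>M) < \<infinity>"
begin

text \<open>This is \<open>H_var\<close> with past and innovation as free arguments, so that
  increments can be estimated pointwise in both before a random path is inserted.\<close>

definition osc :: "nat \<Rightarrow> (nat \<Rightarrow> 'x) \<Rightarrow> 'y \<Rightarrow> ennreal" where
  "osc k w y = (\<integral>\<^sup>+ y'. ennreal (dist (F k (hist k w, y)) (F k (hist k w, y'))) \<partial>P k)"

lemma H_var_eq_osc:
  "\<omega> \<in> space M \<Longrightarrow> H_var M F noise X (Suc k) \<omega> = osc (Suc k) (traj k \<omega>) (noise (Suc k) \<omega>)"
  by (simp add: H_var_def osc_def past_eq_hist)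

lemma osc_measurable[measurable]:
  assumes k: "1 \<le> k" and [measurable]: "f \<in> N \<rightarrow>\<^sub>M PX" "g \<in> N \<rightarrow>\<^sub>M borel"
  shows "(\<lambda>z. osc k (f z) (g z)) \<in> borel_measurable N"
proof -
  interpret Q: prob_space "P k" by (rule prob_space_noise[OF k])
  show ?thesis
    unfolding osc_def by (rule Q.borel_measurable_nn_integral) (use k in measurable)
qed

lemma H_var_measurable[measurable]: "H_var M F noise X (Suc k) \<in> borel_measurable M"
proof -
  have "(\<lambda>\<omega>. osc (Suc k) (traj k \<omega>) (noise (Suc k) \<omega>)) \<in> borel_measurable M" by measurable
  then show ?thesis by (subst measurable_cong) (auto simp: H_var_eq_osc)
qed

lemma space_PX[simp]: "space PX = UNIV" by (simp add: space_PiM)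

lemma F_hist_noise_measurable[measurable]:
  assumes k: "1 \<le> k" and [measurable]: "g \<in> N \<rightarrow>\<^sub>M borel"
  shows "(\<lambda>y. F k (hist k w, g y)) \<in> N \<rightarrow>\<^sub>M borel"
  by (rule F_hist_measurable[OF k]) auto

text \<open>All histories share the deterministic values at times \<le> 0, so the infinite series in
  the contraction reduces to a finite, hence real, sum over the times 1..k-1.\<close>

lemma hist_contraction:
  assumes k: "1 \<le> k"
  shows "(\<integral>\<^sup>+ y. ennreal (dist (F k (hist k u, y)) (F k (hist k u', y))) \<partial>P k)
    \<le> ennreal (\<Sum>i=1..<k. a (k - i) * dist (u i) (u' i))"
proof -
  have "(\<integral>\<^sup>+ y. ennreal (dist (F k (hist k u, y)) (F k (hist k u', y))) \<partial>P k)
      = (\<integral>\<^sup>+ \<omega>. ennreal (dist (F k (hist k u, noise k \<omega>)) (F k (hist k u', noise k \<omega>))) \<partial>M)"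
    by (subst nn_integral_distr) (use k in measurable)
  also have "\<dots> \<le> (\<Sum>j. ennreal (a (Suc j) * dist (hist k u j) (hist k u' j)))"
    by (rule contraction[OF k])
  also have "\<dots> = (\<Sum>j<k - 1. ennreal (a (Suc j) * dist (hist k u j) (hist k u' j)))"
    by (rule suminf_finite) (auto simp: hist_def)
  also have "\<dots> = ennreal (\<Sum>j<k - 1. a (Suc j) * dist (hist k u j) (hist k u' j))"
    using a_nonneg by (intro sum_ennreal) auto
  \<comment> \<open>Lag j + 1 before time k is the coordinate i = k - (j + 1), so the coefficient
    a_{j+1} becomes a_{k-i}.\<close>
  also have "(\<Sum>j<k - 1. a (Suc j) * dist (hist k u j) (hist k u' j)) = (\<Sum>i=1..<k. a (k - i) * dist (u i) (u' i))"
    by (rule sum.reindex_bij_witness[of _ "\<lambda>i. k - Suc i" "\<lambda>j. k - Suc j"]) (auto simp: hist_def Suc_diff_Suc)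
  finally show ?thesis .
qed

text \<open>The centre is the state reached at some \<omega> where H_k is finite, and the
  contraction moves from that past to any other at finite cost. A statement for every
  \<open>w\<close> is needed because the conditional means are defined by integrals at every
  \<open>w\<close>.\<close>

lemma ex_center:
  assumes k: "k \<in> {1..n}"
  shows "\<exists>p. \<forall>w. (\<integral>\<^sup>+ y. ennreal (dist p (F k (hist k w, y))) \<partial>P k) < \<infinity>"
proof -
  from k obtain k' where k': "k = Suc k'" by (cases k) auto
  have k1: "1 \<le> k" using k by simp
  \<comment> \<open>Were H_k infinite everywhere, its second moment would be infinite, since the
    space has mass 1.\<close>
  have "\<exists>\<omega>\<in>space M. H_var M F noise X k \<omega> < \<infinity>"
  proof (rule ccontr)
    assume "\<not> ?thesis"
    then have "(\<integral>\<^sup>+ \<omega>. (H_var M F noise X k \<omega>)\<^sup>2 \<partial>M) = (\<integral>\<^sup>+ \<omega>. \<infinity> \<partial>M)"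
      by (intro nn_integral_cong) (auto simp: less_top[symmetric] power2_eq_square ennreal_top_mult)
    then show False using H_var_L2[OF k] by (simp add: emeasure_space_1)
  qed
  then obtain \<omega> where \<omega>: "\<omega> \<in> space M" "H_var M F noise X k \<omega> < \<infinity>" by blast
  define v where "v = traj k' \<omega>"
  define p where "p = F k (hist k v, noise k \<omega>)"
  have fin: "(\<integral>\<^sup>+ y. ennreal (dist p (F k (hist k v, y))) \<partial>P k) < \<infinity>"
    using \<omega> by (simp add: k' H_var_eq_osc osc_def v_def p_def)
  have "(\<integral>\<^sup>+ y. ennreal (dist p (F k (hist k w, y))) \<partial>P k) < \<infinity>" for w
  proof -
    have "(\<integral>\<^sup>+ y. ennreal (dist p (F k (hist k w, y))) \<partial>P k)
        \<le> (\<integral>\<^sup>+ y. ennreal (dist p (F k (hist k v, y))) + ennreal (dist (F k (hist k v, y)) (F k (hist k w, y))) \<partial>P k)"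
      by (intro nn_integral_mono) (simp flip: ennreal_plus add: dist_triangle)
    also have "\<dots> = (\<integral>\<^sup>+ y. ennreal (dist p (F k (hist k v, y))) \<partial>P k)
        + (\<integral>\<^sup>+ y. ennreal (dist (F k (hist k v, y)) (F k (hist k w, y))) \<partial>P k)"
      by (rule nn_integral_add) (use k1 in measurable)
    also have "\<dots> < \<infinity>"
      using fin le_less_trans[OF hist_contraction[OF k1, of v w]] by simp
    finally show ?thesis .
  qed
  then show ?thesis by blast
qed

section \<open>Integrating one innovation out of a separately Lipschitz function\<close>

context
  fixes g :: "(nat \<Rightarrow> 'x) \<Rightarrow> real" and c :: "nat \<Rightarrow> real" and k :: nat
  assumes k: "k \<in> {1..n}"
    and c: "\<And>i. i \<in> {1..k} \<Longrightarrow> 0 \<le> c i"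
    and g: "\<And>u u'. \<bar>g u - g u'\<bar> \<le> (\<Sum>i=1..k. c i * dist (u i) (u' i))"
begin

lemma fun_upd_lipschitz:
  "\<bar>g (u(k := p)) - g (u'(k := p'))\<bar> \<le> (\<Sum>i=1..<k. c i * dist (u i) (u' i)) + c k * dist p p'"
proof -
  have "{1..k} = insert k {1..<k}" using k by auto
  then have "(\<Sum>i=1..k. c i * dist ((u(k := p)) i) ((u'(k := p')) i)) = (\<Sum>i=1..<k. c i * dist (u i) (u' i)) + c k * dist p p'"
    by simp
  then show ?thesis using g[of "u(k := p)" "u'(k := p')"] by simp
qed

lemma separately_lipschitz_measurable[measurable]: "g \<in> borel_measurable PX"
  by (rule borel_measurable_separately_Lipschitz[OF _ g]) simp

text \<open>Comparing X_k with the point from \<open>ex_center\<close> bounds the integrand by a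
  constant plus \<open>c k\<close> times an integrable distance.\<close>

lemma integrable_step: "integrable (P k) (\<lambda>y. g (step k w y))"
proof -
  interpret Q: prob_space "P k" using k by (intro prob_space_noise) simp
  obtain p where p: "\<And>w. (\<integral>\<^sup>+ y. ennreal (dist p (F k (hist k w, y))) \<partial>P k) < \<infinity>"
    using ex_center[OF k] by blast
  have [simp]: "Suc 0 \<le> k" using k by simp
  have ck: "0 \<le> c k" using c[of k] k by auto
  have "integrable (P k) (\<lambda>y. dist p (F k (hist k w, y)))"
    by (rule integrableI_nonneg) (measurable, use p[of w] in simp_all)
  then have "integrable (P k) (\<lambda>y. c k * dist p (F k (hist k w, y)) + \<bar>g (w(k := p))\<bar>)"
    by (intro Bochner_Integration.integrable_add integrable_mult_right Q.integrable_const)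
  then show ?thesis
  proof (rule Bochner_Integration.integrable_bound)
    show "AE y in P k. norm (g (step k w y)) \<le> norm (c k * dist p (F k (hist k w, y)) + \<bar>g (w(k := p))\<bar>)"
    proof (rule AE_I2)
      fix y
      show "norm (g (step k w y)) \<le> norm (c k * dist p (F k (hist k w, y)) + \<bar>g (w(k := p))\<bar>)"
        using fun_upd_lipschitz[of w p w "F k (hist k w, y)"] ck by (simp add: step_def)
    qed
  qed measurable
qed

text \<open>A change of coordinate i acts directly, with constant c_i, and through the new state
  X_k, whose mean displacement has coefficient a_{k-i}. Both runs use the same innovation.\<close>

lemma integral_step_lipschitz:
  "\<bar>(\<integral>y. g (step k u y) \<partial>P k) - (\<integral>y. g (step k u' y) \<partial>P k)\<bar>
    \<le> (\<Sum>i=1..<k. (c i + c k * a (k - i)) * dist (u i) (u' i))"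
proof -
  interpret Q: prob_space "P k" using k by (intro prob_space_noise) simp
  have [simp]: "Suc 0 \<le> k" using k by simp
  define s where "s = (\<Sum>i=1..<k. c i * dist (u i) (u' i))"
  define r where "r = (\<Sum>i=1..<k. a (k - i) * dist (u i) (u' i))"
  have s: "0 \<le> s" unfolding s_def using c by (intro sum_nonneg mult_nonneg_nonneg) auto
  have r: "0 \<le> r" unfolding r_def using a_nonneg by (intro sum_nonneg mult_nonneg_nonneg) auto
  have ck: "0 \<le> c k" using c[of k] k by auto
  have "ennreal \<bar>(\<integral>y. g (step k u y) \<partial>P k) - (\<integral>y. g (step k u' y) \<partial>P k)\<bar>
      = ennreal (norm (\<integral>y. g (step k u y) - g (step k u' y) \<partial>P k))"
    using integrable_step by simp
  also have "\<dots> \<le> (\<integral>\<^sup>+ y. ennreal (norm (g (step k u y) - g (step k u' y))) \<partial>P k)"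
    by (intro integral_norm_bound_ennreal Bochner_Integration.integrable_diff integrable_step)
  also have "\<dots> \<le> (\<integral>\<^sup>+ y. ennreal s + ennreal (c k) * ennreal (dist (F k (hist k u, y)) (F k (hist k u', y))) \<partial>P k)"
    using fun_upd_lipschitz[of u _ u'] s ck
    by (intro nn_integral_mono) (simp add: step_def s_def flip: ennreal_plus ennreal_mult)
  also have "\<dots> = ennreal s + ennreal (c k) * (\<integral>\<^sup>+ y. ennreal (dist (F k (hist k u, y)) (F k (hist k u', y))) \<partial>P k)"
    using Q.emeasure_space_1 by (subst nn_integral_add) (measurable, simp add: nn_integral_cmult)
  also have "\<dots> \<le> ennreal s + ennreal (c k) * ennreal r"
    unfolding r_def by (intro add_left_mono mult_left_mono hist_contraction) auto
  also have "\<dots> = ennreal (s + c k * r)" using s r ck by (simp add: ennreal_mult)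
  finally have "\<bar>(\<integral>y. g (step k u y) \<partial>P k) - (\<integral>y. g (step k u' y) \<partial>P k)\<bar> \<le> s + c k * r"
    using s r ck by (subst (asm) ennreal_le_iff) auto
  also have "\<dots> = (\<Sum>i=1..<k. (c i + c k * a (k - i)) * dist (u i) (u' i))"
    by (simp add: s_def r_def sum_distrib_left distrib_right sum.distrib mult.assoc)
  finally show ?thesis .
qed

text \<open>The mean is an average over an independent copy y' of the innovation. Both states then
  share the past \<open>w\<close> and differ in coordinate k only, so c_k is the sole
  constant.\<close>

lemma step_deviation_le_osc:
  "ennreal \<bar>g (step k w y) - (\<integral>y'. g (step k w y') \<partial>P k)\<bar> \<le> ennreal (c k) * osc k w y"
proof -
  interpret Q: prob_space "P k" using k by (intro prob_space_noise) simp
  have [simp]: "Suc 0 \<le> k" using k by simp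
  have ck: "0 \<le> c k" using c[of k] k by auto
  have "ennreal \<bar>g (step k w y) - (\<integral>y'. g (step k w y') \<partial>P k)\<bar>
      = ennreal (norm (\<integral>y'. g (step k w y) - g (step k w y') \<partial>P k))"
    using integrable_step Q.prob_space by simp
  also have "\<dots> \<le> (\<integral>\<^sup>+ y'. ennreal (norm (g (step k w y) - g (step k w y'))) \<partial>P k)"
    by (intro integral_norm_bound_ennreal Bochner_Integration.integrable_diff integrable_step) simp
  also have "\<dots> \<le> (\<integral>\<^sup>+ y'. ennreal (c k) * ennreal (dist (F k (hist k w, y)) (F k (hist k w, y'))) \<partial>P k)"
    using fun_upd_lipschitz[of w _ w] ck
    by (intro nn_integral_mono) (simp add: step_def flip: ennreal_mult)
  also have "\<dots> = ennreal (c k) * osc k w y"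
    unfolding osc_def by (rule nn_integral_cmult) measurable
  finally show ?thesis .
qed

end

end

section \<open>The martingale decomposition\<close>

locale contractive_functional = contractive_chain M noise F X x0 a n
  for M :: "'w measure"
    and noise :: "nat \<Rightarrow> 'w \<Rightarrow> 'y::polish_space"
    and F :: "nat \<Rightarrow> (nat \<Rightarrow> 'x::polish_space) \<times> 'y \<Rightarrow> 'x"
    and X :: "int \<Rightarrow> 'w \<Rightarrow> 'x"
    and x0 :: "int \<Rightarrow> 'x"
    and a :: "nat \<Rightarrow> real" and n :: nat +
  fixes f :: "(nat \<Rightarrow> 'x) \<Rightarrow> real"
  assumes f_lipschitz: "\<And>u u'. \<bar>f u - f u'\<bar> \<le> (\<Sum>i=1..n. dist (u i) (u' i))"
begin

lemma one_le_lip: "1 \<le> lip_coef a k"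
  by (rule lip_coef_ge_1) (rule a_nonneg)

lemma lip_mono: "k \<le> l \<Longrightarrow> lip_coef a k \<le> lip_coef a l"
  by (rule lip_coef_mono) (rule a_nonneg)

text \<open>
  \<open>cond_mean j w\<close> is $E[f(X_1,\ldots,X_n) \mid X_1,\ldots,X_{n-j}]$ as a function of
  $w = (X_1,\ldots,X_{n-j})$, and \<open>weight j i\<close> its Lipschitz constant in the $i$-th coordinate.
\<close>

primrec cond_mean :: "nat \<Rightarrow> (nat \<Rightarrow> 'x) \<Rightarrow> real" where
  "cond_mean 0 = f"
| "cond_mean (Suc j) = (\<lambda>w. \<integral>y. cond_mean j (step (n - j) w y) \<partial>P (n - j))"

definition weight :: "nat \<Rightarrow> nat \<Rightarrow> real" where
  "weight j i = 1 + (\<Sum>l<j. lip_coef a l * a (n - l - i))"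

text \<open>Here the numbers a_j(j) arise: at i = n - j the lag n - l - i equals j - l, and the
  formula becomes their recursion.\<close>

lemma weight_last: "j \<le> n \<Longrightarrow> weight j (n - j) = lip_coef a j"
proof -
  assume "j \<le> n"
  then have "n - l - (n - j) = j - l" for l by auto
  then show ?thesis unfolding weight_def by (subst lip_coef_eq) simp
qed

lemma weight_nonneg:
  assumes "j \<le> n" "i \<in> {1..n - j}"
  shows "0 \<le> weight j i"
  unfolding weight_def using assms
  by (intro add_nonneg_nonneg sum_nonneg mult_nonneg_nonneg a_nonneg
      order.trans[OF zero_le_one one_le_lip]) auto

text \<open>One more integration adds \<open>weight j (n - j) * a (n - j - i)\<close>, which by
  \<open>weight_last\<close> is the summand l = j of \<open>weight (Suc j) i\<close>.\<close>

lemma cond_mean_lipschitz: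
  assumes "j \<le> n"
  shows "\<bar>cond_mean j u - cond_mean j u'\<bar> \<le> (\<Sum>i=1..n - j. weight j i * dist (u i) (u' i))"
  using assms
proof (induction j arbitrary: u u')
  case 0
  then show ?case using f_lipschitz by (simp add: weight_def)
next
  case (Suc j)
  have k: "n - j \<in> {1..n}" using Suc.prems by auto
  have "\<bar>cond_mean (Suc j) u - cond_mean (Suc j) u'\<bar>
      \<le> (\<Sum>i=1..<n - j. (weight j i + weight j (n - j) * a (n - j - i)) * dist (u i) (u' i))"
    unfolding cond_mean.simps
    by (rule integral_step_lipschitz[OF k weight_nonneg Suc.IH]) (use Suc.prems in auto)
  also have "\<dots> = (\<Sum>i=1..<n - j. weight (Suc j) i * dist (u i) (u' i))"
    using Suc.prems weight_last[of j] by (simp add: weight_def add.assoc)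
  also have "{1..<n - j} = {1..n - Suc j}" using Suc.prems by auto
  finally show ?case .
qed

lemma cond_mean_measurable[measurable]: "j \<le> n \<Longrightarrow> cond_mean j \<in> borel_measurable PX"
  by (rule borel_measurable_separately_Lipschitz[OF _ cond_mean_lipschitz]) auto

text \<open>The martingale difference D_k. For 1 \<le> k \<le> n, \<open>Suc (n - k)\<close> is n -
  (k - 1), the stage that belongs to the history up to k - 1.\<close>

definition incr :: "nat \<Rightarrow> 'w \<Rightarrow> real" where
  "incr k \<omega> = cond_mean (n - k) (traj k \<omega>) - cond_mean (Suc (n - k)) (traj (k - 1) \<omega>)"

lemma cond_mean_Suc:
  "k < n \<Longrightarrow> cond_mean (n - k) w = (\<integral>y. cond_mean (n - Suc k) (step (Suc k) w y) \<partial>P (Suc k))"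
proof -
  assume "k < n"
  then have "n - k = Suc (n - Suc k)" "n - (n - Suc k) = Suc k" by auto
  then show ?thesis by (metis cond_mean.simps(2))
qed

lemma incr_Suc:
  assumes "k < n" "\<omega> \<in> space M"
  shows "incr (Suc k) \<omega> = cond_mean (n - Suc k) (step (Suc k) (traj k \<omega>) (noise (Suc k) \<omega>)) - cond_mean (n - k) (traj k \<omega>)"
  using assms by (simp add: incr_def traj_Suc Suc_diff_Suc del: cond_mean.simps)

lemma incr_measurable[measurable]:
  assumes "k \<in> {1..n}"
  shows "incr k \<in> borel_measurable M"
proof -
  have "n - k \<le> n" "Suc (n - k) \<le> n" using assms by auto
  then show ?thesis unfolding incr_def by measurable
qed

lemma sum_incr:
  "k \<le> n \<Longrightarrow> (\<Sum>i=1..k. incr i \<omega>) = cond_mean (n - k) (traj k \<omega>) - cond_mean n (traj 0 \<omega>)"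
proof (induction k)
  case (Suc k)
  then have "Suc (n - Suc k) = n - k" by auto
  then show ?case using Suc by (simp add: incr_def del: cond_mean.simps)
qed simp

lemma
  assumes "k < n"
  shows integrable_cond_mean_step: "integrable (P (Suc k)) (\<lambda>y. cond_mean (n - Suc k) (step (Suc k) w y))"
    and cond_mean_deviation: "ennreal \<bar>cond_mean (n - Suc k) (step (Suc k) w y) - cond_mean (n - k) w\<bar>
      \<le> ennreal (lip_coef a (n - Suc k)) * osc (Suc k) w y"
proof -
  have k: "Suc k \<in> {1..n}" and j: "n - Suc k \<le> n" "n - (n - Suc k) = Suc k" using assms by auto
  have w: "0 \<le> weight (n - Suc k) i" if "i \<in> {1..Suc k}" for i
    using weight_nonneg[of "n - Suc k" i] that j by simp
  note L = cond_mean_lipschitz[OF j(1), unfolded j(2)]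
  show "integrable (P (Suc k)) (\<lambda>y. cond_mean (n - Suc k) (step (Suc k) w y))"
    by (rule integrable_step[OF k w L])
  show "ennreal \<bar>cond_mean (n - Suc k) (step (Suc k) w y) - cond_mean (n - k) w\<bar>
      \<le> ennreal (lip_coef a (n - Suc k)) * osc (Suc k) w y"
    using step_deviation_le_osc[OF k w L, of w y] weight_last[OF j(1)] j(2)
    by (simp add: cond_mean_Suc[OF assms])
qed

lemma incr_le_H_var:
  assumes "k \<in> {1..n}" "\<omega> \<in> space M"
  shows "ennreal \<bar>incr k \<omega>\<bar> \<le> ennreal (lip_coef a (n - k)) * H_var M F noise X k \<omega>"
proof -
  obtain k' where "k = Suc k'" using assms(1) by (cases k) auto
  with assms show ?thesis by (simp add: incr_Suc H_var_eq_osc cond_mean_deviation)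
qed

lemma nn_integral_incr_power_le:
  assumes k: "k \<in> {1..n}"
  shows "(\<integral>\<^sup>+\<omega>. ennreal (\<bar>incr k \<omega>\<bar> ^ l) \<partial>M)
    \<le> ennreal (lip_coef a (n - k) ^ l) * (\<integral>\<^sup>+\<omega>. (H_var M F noise X k \<omega>) ^ l \<partial>M)"
proof -
  have [measurable]: "H_var M F noise X k \<in> borel_measurable M"
    using k H_var_measurable[of "k - 1"] by simp
  have lip: "0 \<le> lip_coef a (n - k)" using one_le_lip[of "n - k"] by simp
  have "(\<integral>\<^sup>+\<omega>. ennreal (\<bar>incr k \<omega>\<bar> ^ l) \<partial>M)
      \<le> (\<integral>\<^sup>+\<omega>. (ennreal (lip_coef a (n - k)) * H_var M F noise X k \<omega>) ^ l \<partial>M)"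
    by (intro nn_integral_mono) (simp add: incr_le_H_var[OF k] power_mono flip: ennreal_power)
  also have "\<dots> = ennreal (lip_coef a (n - k) ^ l) * (\<integral>\<^sup>+\<omega>. (H_var M F noise X k \<omega>) ^ l \<partial>M)"
    using lip by (simp add: power_mult_distrib ennreal_power nn_integral_cmult)
  finally show ?thesis .
qed

text \<open>Given the past, D_{k+1} has mean zero under the law of the next innovation. The choice
  \<phi> = 1 makes the increments centred; signed powers of the partial sums give the orthogonality
  for Rio's inequality.\<close>

lemma incr_orthogonal:
  assumes k: "k < n" and [measurable]: "\<phi> \<in> borel_measurable PX"
  shows "(\<integral>\<omega>. \<phi> (traj k \<omega>) * incr (Suc k) \<omega> \<partial>M) = (0 :: real)"
proof -
  interpret Q: prob_space "P (Suc k)" by (rule prob_space_noise) simp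
  define h where "h z = \<phi> (fst z) * (cond_mean (n - Suc k) (step (Suc k) (fst z) (snd z)) - cond_mean (n - k) (fst z))" for z
  have "(\<integral>\<omega>. \<phi> (traj k \<omega>) * incr (Suc k) \<omega> \<partial>M) = (\<integral>\<omega>. h (traj k \<omega>, noise (Suc k) \<omega>) \<partial>M)"
    by (rule Bochner_Integration.integral_cong) (simp_all add: h_def incr_Suc[OF k])
  also have "\<dots> = 0"
  proof (rule integral_increment_eq_0)
    show "h \<in> borel_measurable (PX \<Otimes>\<^sub>M borel)" unfolding h_def by measurable
    show "(\<integral>y. h (w, y) \<partial>P (Suc k)) = 0" for w
      using integrable_cond_mean_step[OF k, of w] Q.prob_space
      by (simp add: h_def cond_mean_Suc[OF k])
  qed
  finally show ?thesis .
qed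

text \<open>The padding of \<open>traj\<close> is invisible to \<open>f\<close>, whose Lipschitz
  bound sums over 1..n only.\<close>

lemma f_eq_cond_mean_traj: "f (\<lambda>i. X (int i) \<omega>) = cond_mean 0 (traj n \<omega>)"
proof -
  have "(\<Sum>i=1..n. dist (X (int i) \<omega>) (traj n \<omega> i)) = 0"
    by (rule sum.neutral) (simp add: traj_def)
  then show ?thesis using f_lipschitz[of "\<lambda>i. X (int i) \<omega>" "traj n \<omega>"] by simp
qed

text \<open>At stage n no coordinate remains in the Lipschitz bound, so the sum is empty.\<close>

lemma cond_mean_n_const: "cond_mean n u = cond_mean n u'"
  using cond_mean_lipschitz[of n u u'] by simp

end

section \<open>From moments of the increments to the deviation bound\<close>

context contractive_functional
begin

lemma concentration:
  fixes \<epsilon> s x :: real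
  assumes n: "n \<ge> 1" and eps: "\<epsilon> > 0"
    and mom: "\<And>k l. k \<ge> 1 \<Longrightarrow> l \<ge> 2 \<Longrightarrow>
           (\<integral>\<^sup>+ \<omega>. (H_var M F noise X k \<omega>) ^ l \<partial>M)
             \<le> ennreal (1 / 2 * (fact l * \<epsilon> ^ (l - 2) / (real l - 1) powr (real l / 2)))
                 * (\<integral>\<^sup>+ \<omega>. (H_var M F noise X k \<omega>)\<^sup>2 \<partial>M)"
    and pos: "0 < V_sq M F noise X a n"
    and s: "s \<in> {1, -1}" and x: "x > 0"
  defines "S \<equiv> \<lambda>\<omega>. f (\<lambda>i. X (int i) \<omega>) - (\<integral>\<omega>'. f (\<lambda>i. X (int i) \<omega>') \<partial>M)"
    and "V \<equiv> sqrt (enn2real (V_sq M F noise X a n))"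
  defines "b \<equiv> x * (sqrt (real n) * \<epsilon> * lip_coef a (n - 1)) / V"
  shows "prob {\<omega> \<in> space M. s * S \<omega> \<ge> x * V} \<le> exp (- x\<^sup>2 / (1 + sqrt (1 + 2 * b) + b))"
proof -
  define h where "h k = enn2real (\<integral>\<^sup>+ \<omega>. (H_var M F noise X k \<omega>)\<^sup>2 \<partial>M)" for k
  define L where "L = lip_coef a (n - 1)"
  \<comment> \<open>The numerical factor of the moment hypothesis at l = m + 2, so that l - 1 = m +
    1 and l - 2 = m.\<close>
  define \<kappa> where "\<kappa> m = 1 / 2 * (fact (m + 2) * \<epsilon> ^ m / (real m + 1) powr ((real m + 2) / 2))" for m
  define T where "T k \<omega> = (\<Sum>i=1..k. incr i \<omega>)" for k \<omega>
  have \<kappa>0: "0 \<le> \<kappa> m" for m using eps by (simp add: \<kappa>_def)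
  have h0: "0 \<le> h k" for k by (simp add: h_def)
  have h: "(\<integral>\<^sup>+ \<omega>. (H_var M F noise X k \<omega>)\<^sup>2 \<partial>M) = ennreal (h k)" if "k \<in> {1..n}" for k
    unfolding h_def using H_var_L2[OF that] by simp
  have lip1: "1 \<le> lip_coef a k" for k by (rule one_le_lip)
  then have lip0: "0 \<le> lip_coef a k" for k using order.trans[OF zero_le_one] by blast
  have L1: "1 \<le> L" using lip1 by (simp add: L_def)
  define v where "v = (\<Sum>k=1..n. (lip_coef a (n - k))\<^sup>2 * h k)"
  have v0: "0 \<le> v" unfolding v_def using h0 by (intro sum_nonneg) auto
  have Vsq: "V_sq M F noise X a n = ennreal v"
  proof -
    have "V_sq M F noise X a n = (\<Sum>k=1..n. ennreal ((lip_coef a (n - k))\<^sup>2 * h k))"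
      unfolding V_sq_def by (rule sum.cong) (simp_all add: h ennreal_mult h0)
    then show ?thesis unfolding v_def using h0 by (subst (asm) sum_ennreal) auto
  qed
  have v: "0 < v" using pos unfolding Vsq by simp
  have V: "V\<^sup>2 = v" "0 < V" using v by (simp_all add: V_def Vsq)
  have D_nn: "(\<integral>\<^sup>+\<omega>. ennreal (\<bar>incr k \<omega>\<bar> ^ (m + 2)) \<partial>M)
      \<le> ennreal (\<kappa> m * L ^ m * ((lip_coef a (n - k))\<^sup>2 * h k))" if k: "k \<in> {1..n}" for k m
  proof -
    have "(\<integral>\<^sup>+\<omega>. ennreal (\<bar>incr k \<omega>\<bar> ^ (m + 2)) \<partial>M)
        \<le> ennreal (lip_coef a (n - k) ^ (m + 2)) * (\<integral>\<^sup>+\<omega>. (H_var M F noise X k \<omega>) ^ (m + 2) \<partial>M)"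
      by (rule nn_integral_incr_power_le[OF k])
    also have "\<dots> \<le> ennreal (lip_coef a (n - k) ^ (m + 2)) * (ennreal (\<kappa> m) * ennreal (h k))"
    proof (rule mult_left_mono)
      have "real (m + 2) - 1 = real m + 1" "real (m + 2) = real m + 2" by simp_all
      then show "(\<integral>\<^sup>+\<omega>. (H_var M F noise X k \<omega>) ^ (m + 2) \<partial>M) \<le> ennreal (\<kappa> m) * ennreal (h k)"
        using mom[of k "m + 2"] k h[OF k] unfolding \<kappa>_def by (simp add: add_ac)
    qed simp
    also have "\<dots> = ennreal (lip_coef a (n - k) ^ m * ((lip_coef a (n - k))\<^sup>2 * (\<kappa> m * h k)))"
      using \<kappa>0 h0 lip0 by (simp add: ennreal_mult[symmetric] power_add power2_eq_square mult.assoc)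
    \<comment> \<open>Only m of the m + 2 coefficient factors are enlarged to \<open>L\<close>; the
      remaining two keep their index, so that summation over k reproduces V_n^2.\<close>
    also have "\<dots> \<le> ennreal (L ^ m * ((lip_coef a (n - k))\<^sup>2 * (\<kappa> m * h k)))"
      unfolding L_def using k \<kappa>0 h0 lip0
      by (intro ennreal_leI mult_right_mono power_mono lip_mono) auto
    finally show ?thesis by (simp add: mult_ac)
  qed
  have D_int: "integrable M (\<lambda>\<omega>. \<bar>incr k \<omega>\<bar> ^ (m + 2))" if "k \<in> {1..n}" for k m
    using le_less_trans[OF D_nn[OF that]] that by (intro integrableI_nonneg) auto
  have D_le: "(\<integral>\<omega>. \<bar>incr k \<omega>\<bar> ^ (m + 2) \<partial>M) \<le> \<kappa> m * L ^ m * ((lip_coef a (n - k))\<^sup>2 * h k)"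
    if "k \<in> {1..n}" for k m
    using D_nn[OF that, of m] nn_integral_eq_integral[OF D_int[OF that, of m]] \<kappa>0 h0 L1
    by (simp del: power_add_numeral add_2_eq_Suc')
  have D_int1: "integrable M (incr k)" if "k \<in> {1..n}" for k
    using D_int[OF that, of 0, unfolded add_0 power2_abs]
    by (rule square_integrable_imp_integrable[OF incr_measurable[OF that]])
  have T_eq: "T k \<omega> = cond_mean (n - k) (traj k \<omega>) - cond_mean n (\<lambda>_. x0 0)" if "k \<le> n" for k \<omega>
    using sum_incr[OF that, of \<omega>] cond_mean_n_const[of "traj 0 \<omega>" "\<lambda>_. x0 0"] by (simp add: T_def)
  have orth: "(\<integral>\<omega>. (T k \<omega> * \<bar>T k \<omega>\<bar> ^ m) * incr (Suc k) \<omega> \<partial>M) = 0" if "k < n" for k m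
  proof -
    define c where "c = cond_mean n (\<lambda>_. x0 0)"
    have [measurable]: "cond_mean (n - k) \<in> borel_measurable PX" by measurable
    have "(\<lambda>w. (cond_mean (n - k) w - c) * \<bar>cond_mean (n - k) w - c\<bar> ^ m) \<in> borel_measurable PX"
      by measurable
    from incr_orthogonal[OF that this] show ?thesis using that by (simp add: T_eq c_def)
  qed
  have T_mom: "integrable M (\<lambda>\<omega>. \<bar>T n \<omega>\<bar> ^ (m + 2))"
    "(\<integral>\<omega>. \<bar>T n \<omega>\<bar> ^ (m + 2) \<partial>M)
      \<le> (real m + 1) powr ((real m + 2) / 2) * real n powr (real m / 2) * (\<Sum>k=1..n. \<integral>\<omega>. \<bar>incr k \<omega>\<bar> ^ (m + 2) \<partial>M)" for m
    unfolding T_def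
    by (rule martingale_moment_le[OF incr_measurable D_int orth[unfolded T_def]]; assumption)+
  define C where "C = sqrt (real n) * \<epsilon> * L"
  have T_le: "(\<integral>\<omega>. \<bar>T n \<omega>\<bar> ^ (m + 2) \<partial>M) \<le> 1 / 2 * fact (m + 2) * C ^ m * V\<^sup>2" for m
  proof -
    define A where "A = (real m + 1) powr ((real m + 2) / 2)"
    have A: "0 < A" by (simp add: A_def)
    have "(\<integral>\<omega>. \<bar>T n \<omega>\<bar> ^ (m + 2) \<partial>M)
        \<le> A * real n powr (real m / 2) * (\<Sum>k=1..n. \<kappa> m * L ^ m * ((lip_coef a (n - k))\<^sup>2 * h k))"
      unfolding A_def by (rule order.trans[OF T_mom(2)]) (intro mult_left_mono sum_mono D_le; simp)
    also have "\<dots> = A * real n powr (real m / 2) * (\<kappa> m * L ^ m * v)"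
      by (simp add: v_def sum_distrib_left)
    also have "real n powr (real m / 2) = sqrt (real n) ^ m"
      using n by (simp add: powr_half_sqrt[symmetric] powr_realpow[symmetric] powr_powr)
    also have "A * sqrt (real n) ^ m * (\<kappa> m * L ^ m * v) = (A * \<kappa> m) * (sqrt (real n) * L) ^ m * v"
      by (simp add: power_mult_distrib)
    also have "A * \<kappa> m = 1 / 2 * fact (m + 2) * \<epsilon> ^ m"
      using A by (simp add: \<kappa>_def A_def[symmetric])
    also have "1 / 2 * fact (m + 2) * \<epsilon> ^ m * (sqrt (real n) * L) ^ m * v = 1 / 2 * fact (m + 2) * C ^ m * V\<^sup>2"
      by (simp add: C_def V(1) power_mult_distrib mult_ac)
    finally show ?thesis .
  qed
  have T_int: "integrable M (T n)"
    unfolding T_def by (intro Bochner_Integration.integrable_sum D_int1)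
  have ET: "expectation (T n) = 0"
  proof -
    have "expectation (incr k) = 0" if "k \<in> {1..n}" for k
      using incr_orthogonal[of "k - 1" "\<lambda>_. 1"] that by (cases k) auto
    then show ?thesis unfolding T_def using D_int1 by (subst Bochner_Integration.integral_sum) auto
  qed
  have f_eq: "f (\<lambda>i. X (int i) \<omega>) = T n \<omega> + cond_mean n (\<lambda>_. x0 0)" for \<omega>
    by (simp only: f_eq_cond_mean_traj T_eq[OF order.refl]) simp
  \<comment> \<open>As \<open>T n\<close> is centred, the constant \<open>cond_mean n\<close> must
    be the mean of f, so the telescoped sum is S_n itself.\<close>
  have S: "S = T n"
    unfolding S_def f_eq using T_int ET prob_space by (simp add: fun_eq_iff)
  have abs_s: "\<bar>s * r\<bar> = \<bar>r\<bar>" for r using s by auto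
  have "prob {\<omega> \<in> space M. s * T n \<omega> \<ge> x * V} \<le> exp (- x\<^sup>2 / (1 + sqrt (1 + 2 * (x * C / V)) + x * C / V))"
  proof (rule bernstein_inequality)
    show "integrable M (\<lambda>\<omega>. s * T n \<omega>)" using T_int by simp
    show "expectation (\<lambda>\<omega>. s * T n \<omega>) = 0" using ET by simp
    show "(\<integral>\<^sup>+\<omega>. ennreal (\<bar>s * T n \<omega>\<bar> ^ (m + 2)) \<partial>M) \<le> ennreal (1 / 2 * fact (m + 2) * C ^ m * V\<^sup>2)" for m
      unfolding abs_s using T_le[of m]
      by (subst nn_integral_eq_integral[OF T_mom(1)]) (auto intro!: ennreal_leI)
    show "0 < C" using n eps L1 by (simp add: C_def)
  qed (use V x in auto)
  then show ?thesis by (simp add: S b_def C_def L_def)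
qed

end

theorem proposition4p2:
  fixes M :: "'w measure"
    and noise :: "nat \<Rightarrow> 'w \<Rightarrow> 'y::polish_space"
    and F :: "nat \<Rightarrow> (nat \<Rightarrow> 'x::polish_space) \<times> 'y \<Rightarrow> 'x"
    and X :: "int \<Rightarrow> 'w \<Rightarrow> 'x"
    and x0 :: "int \<Rightarrow> 'x"
    and a :: "nat \<Rightarrow> real"
    and f :: "(nat \<Rightarrow> 'x) \<Rightarrow> real"
    and n :: nat
    and \<epsilon> s x :: real
  assumes "prob_space M"
    and "prob_space.indep_vars M (\<lambda>_. borel) noise {1..}"
    and "\<And>m. m \<ge> 1 \<Longrightarrow> F m \<in> ((\<Pi>\<^sub>M j\<in>UNIV. borel) \<Otimes>\<^sub>M borel) \<rightarrow>\<^sub>M borel"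
    and "\<And>i \<omega>. i \<le> 0 \<Longrightarrow> \<omega> \<in> space M \<Longrightarrow> X i \<omega> = x0 i"
    and "\<And>m \<omega>. m \<ge> 1 \<Longrightarrow> \<omega> \<in> space M \<Longrightarrow> X (int m) \<omega> = F m (past X m \<omega>, noise m \<omega>)"
    and "\<And>i. i \<ge> 1 \<Longrightarrow> a i \<ge> 0"
    and "summable (\<lambda>j. a (Suc j))"
    and "(\<Sum>j. a (Suc j)) < 1"
    and "\<And>m u u'. m \<ge> 1 \<Longrightarrow>
           (\<integral>\<^sup>+ \<omega>. ennreal (dist (F m (u, noise m \<omega>)) (F m (u', noise m \<omega>))) \<partial>M)
             \<le> (\<Sum>j. ennreal (a (Suc j) * dist (u j) (u' j)))"
    and "n \<ge> 1"
    and "\<And>u u'. \<bar>f u - f u'\<bar> \<le> (\<Sum>i=1..n. dist (u i) (u' i))"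
    and "\<epsilon> > 0"
    and "\<And>k l. k \<ge> 1 \<Longrightarrow> l \<ge> 2 \<Longrightarrow>
           (\<integral>\<^sup>+ \<omega>. (H_var M F noise X k \<omega>) ^ l \<partial>M)
             \<le> ennreal (1 / 2 * (fact l * \<epsilon> ^ (l - 2) / (real l - 1) powr (real l / 2)))
                 * (\<integral>\<^sup>+ \<omega>. (H_var M F noise X k \<omega>)\<^sup>2 \<partial>M)"
    and "0 < V_sq M F noise X a n"
    and "V_sq M F noise X a n < \<infinity>"
    and "s \<in> {1, -1}"
    and "x > 0"
  shows "let S = (\<lambda>\<omega>. f (\<lambda>i. X (int i) \<omega>) - (\<integral>\<omega>'. f (\<lambda>i. X (int i) \<omega>') \<partial>M));
             V = sqrt (enn2real (V_sq M F noise X a n));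
             \<sigma> = sqrt (1 / real n * V\<^sup>2);
             b = x * \<epsilon> * lip_coef a (n - 1) / \<sigma>
         in measure M {\<omega> \<in> space M. s * S \<omega> \<ge> x * V}
              \<le> exp (- x\<^sup>2 / (1 + sqrt (1 + 2 * b) + b))
          \<and> exp (- x\<^sup>2 / (1 + sqrt (1 + 2 * b) + b)) \<le> exp (- x\<^sup>2 / (2 * (1 + b)))"
proof -
  \<comment> \<open>Every coefficient in V_n^2 is at least 1, so finiteness of V_n bounds each
    second moment separately.\<close>
  have H_L2: "(\<integral>\<^sup>+ \<omega>. (H_var M F noise X k \<omega>)\<^sup>2 \<partial>M) < \<infinity>" if k: "k \<in> {1..n}" for k
  proof -
    have "1 \<le> lip_coef a (n - k)" by (rule lip_coef_ge_1) (rule assms(6))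
    then have lip: "1 \<le> (lip_coef a (n - k))\<^sup>2" by (rule one_le_power)
    have "(\<integral>\<^sup>+ \<omega>. (H_var M F noise X k \<omega>)\<^sup>2 \<partial>M) = ennreal 1 * (\<integral>\<^sup>+ \<omega>. (H_var M F noise X k \<omega>)\<^sup>2 \<partial>M)" by simp
    also have "\<dots> \<le> ennreal ((lip_coef a (n - k))\<^sup>2) * (\<integral>\<^sup>+ \<omega>. (H_var M F noise X k \<omega>)\<^sup>2 \<partial>M)"
      by (intro mult_right_mono ennreal_leI lip) simp
    also have "\<dots> \<le> V_sq M F noise X a n"
      unfolding V_sq_def using k by (intro member_le_sum) auto
    finally show ?thesis using assms(15) by (rule le_less_trans)
  qed
  interpret prob_space M by (rule assms(1))
  interpret contractive_functional M noise F X x0 a n f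
    by unfold_locales (fact assms H_L2)+
  define V where "V = sqrt (enn2real (V_sq M F noise X a n))"
  define \<sigma> where "\<sigma> = sqrt (1 / real n * V\<^sup>2)"
  define b where "b = x * \<epsilon> * lip_coef a (n - 1) / \<sigma>"
  have V: "0 < V" unfolding V_def using assms(14,15) by (simp add: enn2real_positive_iff less_top)
  then have \<sigma>: "\<sigma> = V / sqrt (real n)" by (simp add: \<sigma>_def real_sqrt_divide)
  have b_eq: "b = x * (sqrt (real n) * \<epsilon> * lip_coef a (n - 1)) / V"
    by (simp add: b_def \<sigma>)
  have "0 \<le> lip_coef a (n - 1)"
    using one_le_lip[of "n - 1"] by linarith
  then have b0: "0 \<le> b" using V assms(12,17) by (simp add: b_eq)
  have "prob {\<omega> \<in> space M. s * (f (\<lambda>i. X (int i) \<omega>) - (\<integral>\<omega>'. f (\<lambda>i. X (int i) \<omega>') \<partial>M)) \<ge> x * V}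
      \<le> exp (- x\<^sup>2 / (1 + sqrt (1 + 2 * b) + b))"
    unfolding V_def b_eq by (rule concentration[OF assms(10,12,13,14,16,17)])
  moreover have "exp (- x\<^sup>2 / (1 + sqrt (1 + 2 * b) + b)) \<le> exp (- x\<^sup>2 / (2 * (1 + b)))"
  proof -
    \<comment> \<open>The second inequality rests on sqrt (1 + 2 b) \<le> 1 + b, which bounds the
      first denominator by 2 (1 + b).\<close>
    have "1 + 2 * b \<le> (1 + b)\<^sup>2" by (simp add: power2_eq_square algebra_simps)
    then have "sqrt (1 + 2 * b) \<le> 1 + b" using b0 by (intro real_le_lsqrt) auto
    then have "x\<^sup>2 / (2 * (1 + b)) \<le> x\<^sup>2 / (1 + sqrt (1 + 2 * b) + b)"
      using b0 by (intro divide_left_mono mult_pos_pos add_pos_nonneg) auto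
    then show ?thesis by simp
  qed
  ultimately show ?thesis
    unfolding Let_def b_def \<sigma>_def V_def by blast
qed

end
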